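(* Let $\Lambda$ be a finite nonempty set, let $A \subset \Gamma = \Lambda^*\times\Lambda^*$ satisfy $\overline{d}(A) > 0$, and let $u,v \in \mathbb{Z}_{>0}^2$. Then for every $r > 0$ there exists $n \in \mathbb{Z}_{>0}$ such that there is an $(nu,nv)$-arithmetic product tree of order $r$ in $A$.
   Context: $\Lambda^*$ is the free monoid of finite words over $\Lambda$ (identity the empty word $\emptyset$), $|w|$ the word length. $\Gamma = \Lambda^* \times \Lambda^*$ with coordinatewise multiplication; $\operatorname{Level}(w_1,w_2) = (|w_1|,|w_2|)$; $L_{i,j}=\{\gamma\in\Gamma:\operatorname{Level}(\gamma)=(i,j)\}$; $\overline{d}(A) = \limsup_{N\to\infty}\frac{1}{N^2}\sum_{i,j=0}^{N-1}\frac{|A\cap L_{i,j}|}{|L_{i,j}|}$. In a semigroup $S$, $s'$ is a descendent of $s$ if $s' = st$ for some $t \in S$. $\widetilde{\Gamma} = \Lambda^* * \Lambda^*$ is the free monoid generated by the disjoint set of letters $\{X_\lambda : \lambda\in\Lambda\}\sqcup\{Y_\lambda:\lambda\in\Lambda\}$; $B_r(\widetilde\Gamma)$ is the set of words in $\widetilde\Gamma$ of length at most $r$. For $\gamma = (w_1,w_2) \in \Gamma$ put $\gamma X_\lambda = (w_1\lambda, w_2)$ and $\gamma Y_\lambda = (w_1, w_2\lambda)$. For $u,v \in \mathbb{Z}_{\ge 0}^2$, a $(u,v)$-arithmetic product tree of order $r$ in $A$ is a map $\phi : B_r(\widetilde\Gamma)\to A$ such that for all $\gamma \in B_{r-1}(\widetilde\Gamma)$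 and $\lambda\in\Lambda$: (1) $\operatorname{Level}(\phi(\gamma X_\lambda)) = \operatorname{Level}(\phi(\gamma)) + u$ and $\operatorname{Level}(\phi(\gamma Y_\lambda)) = \operatorname{Level}(\phi(\gamma)) + v$ (here $\gamma X_\lambda,\gamma Y_\lambda$ are products in $\widetilde\Gamma$); (2) $\phi(\gamma X_\lambda)$ is a descendent (in $\Gamma$) of $\phi(\gamma) X_\lambda$ and $\phi(\gamma Y_\lambda)$ is a descendent of $\phi(\gamma)Y_\lambda$. *)

theory Defs
  imports Complex_Main "HOL-Library.Extended_Real" "HOL-Library.Product_Plus"
begin

text \<open>
  The finite nonempty alphabet \<open>\<Lambda>\<close> is the type variable \<open>'a::finite\<close>; the free monoid \<open>\<Lambda>\<^sup>*\<close> is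
  \<open>'a list\<close> under append.
\<close>

type_synonym 'a Gam = "'a list \<times> 'a list"

definition Gam_mult :: "'a Gam \<Rightarrow> 'a Gam \<Rightarrow> 'a Gam" where
  "Gam_mult \<gamma> \<delta> = (fst \<gamma> @ fst \<delta>, snd \<gamma> @ snd \<delta>)"

definition Level :: "'a Gam \<Rightarrow> nat \<times> nat" where
  "Level \<gamma> = (length (fst \<gamma>), length (snd \<gamma>))"

definition level_set :: "nat \<Rightarrow> nat \<Rightarrow> 'a Gam set" where
  "level_set i j = {\<gamma>. Level \<gamma> = (i, j)}"

text \<open>The averages lie in \<open>[0, 1]\<close>; \<open>ereal\<close> is used only so that the library's \<open>limsup\<close> applies.\<close>

definition upper_density :: "('a::finite) Gam set \<Rightarrow> ereal" where
  "upper_density A = limsup (\<lambda>N. ereal (1 / (real N)\<^sup>2 *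
     (\<Sum>i<N. \<Sum>j<N. real (card (A \<inter> level_set i j)) / real (card (level_set i j :: 'a Gam set)))))"

definition descendent :: "('s \<Rightarrow> 's \<Rightarrow> 's) \<Rightarrow> 's \<Rightarrow> 's \<Rightarrow> bool" where
  "descendent mult s' s \<longleftrightarrow> (\<exists>t. s' = mult s t)"

definition Gam_X :: "'a Gam \<Rightarrow> 'a \<Rightarrow> 'a Gam" where
  "Gam_X \<gamma> l = (fst \<gamma> @ [l], snd \<gamma>)"

definition Gam_Y :: "'a Gam \<Rightarrow> 'a \<Rightarrow> 'a Gam" where
  "Gam_Y \<gamma> l = (fst \<gamma>, snd \<gamma> @ [l])"

text \<open>
  The free product \<open>\<Lambda>\<^sup>* * \<Lambda>\<^sup>*\<close>: words over the disjoint union of two copies of the alphabet, where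
  \<open>Inl l\<close> is the letter \<open>X\<^sub>l\<close> and \<open>Inr l\<close> is the letter \<open>Y\<^sub>l\<close>.
\<close>

type_synonym 'a free_Gam = "('a + 'a) list"

definition word_ball :: "nat \<Rightarrow> 'a free_Gam set" where
  "word_ball r = {w. length w \<le> r}"

text \<open>
  Only the values of \<open>\<phi>\<close> on \<open>word_ball r\<close> matter. The condition \<open>length \<gamma> < r\<close> expresses membership
  in the ball of radius \<open>r - 1\<close> without truncated subtraction at \<open>r = 0\<close>.
\<close>

definition arithmetic_product_tree ::
  "nat \<times> nat \<Rightarrow> nat \<times> nat \<Rightarrow> nat \<Rightarrow> 'a Gam set \<Rightarrow> ('a free_Gam \<Rightarrow> 'a Gam) \<Rightarrow> bool" where
  "arithmetic_product_tree u v r A \<phi> \<longleftrightarrow>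
     (\<forall>\<gamma>\<in>word_ball r. \<phi> \<gamma> \<in> A) \<and>
     (\<forall>\<gamma> l. length \<gamma> < r \<longrightarrow>
        Level (\<phi> (\<gamma> @ [Inl l])) = Level (\<phi> \<gamma>) + u \<and>
        Level (\<phi> (\<gamma> @ [Inr l])) = Level (\<phi> \<gamma>) + v \<and>
        descendent Gam_mult (\<phi> (\<gamma> @ [Inl l])) (Gam_X (\<phi> \<gamma>) l) \<and>
        descendent Gam_mult (\<phi> (\<gamma> @ [Inr l])) (Gam_Y (\<phi> \<gamma>) l))"

definition scale :: "nat \<Rightarrow> nat \<times> nat \<Rightarrow> nat \<times> nat" where
  "scale n u = (n * fst u, n * snd u)"

end

theory Submission
  imports Defs
begin

text \<open>
  The input from density Ramsey theory is the density Hales--Jewett theorem. It is proved by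
  induction on the alphabet, in the density increment style of Polymath and of Dodos,
  Kanellopoulos and Tyros: a dense subset of \<open>[k + 1]\<^sup>n\<close> without lines correlates with an intersection
  of insensitive sets, and such an intersection is almost a disjoint union of large subspaces.

  To pass to trees, let \<open>g\<close> be the density of \<open>A\<close> among the descendents of a node at relative level
  \<open>(K, K)\<close>. The second moment of \<open>g\<close> decreases in \<open>K\<close>, so for a suitable \<open>K\<close> it is almost stationary.
  Then, for all levels \<open>t\<close> in a prescribed range, the value of \<open>g\<close> at a random descendent of \<open>\<gamma>\<close> at
  relative level \<open>t\<close> is almost determined by \<open>\<gamma>\<close>. Density Hales--Jewett, applied to words whose letters
  are the pairs \<open>(a, b)\<close> with \<open>a, b \<le> r\<close>, yields \<open>\<gamma>\<close> such that this value is bounded below at all levels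
  \<open>s + m (a u + b v)\<close>, hence at almost all descendents of \<open>\<gamma>\<close> at these levels. As \<open>m\<close> exceeds \<open>K\<close>, almost
  all nodes there can be extended one step further, and the tree is built by induction on its order.
\<close>

section \<open>Averages over finite sets\<close>

text \<open>Density Hales--Jewett is applied to levels, not to elements of \<Gamma>: a word over the
  pairs prescribes a relative level, and the dense set consists of the words at whose level \<gamma>
  has density at least \<open>\<epsilon> / 4\<close>. Pairs suffice as letters because the level of
  a tree node depends only on the numbers of X- and Y-letters in its name.

  A tree step needs room: from a skeleton node one climbs by \<open>(K, K)\<close> to a point of A,
  appends a letter and continues to the next skeleton node. All this must fit into
  \<open>m u\<close> and \<open>m v\<close>, while K is only found by the energy argument. So the
  Hales--Jewett dimension is fixed first, from \<epsilon> and r alone, and the levels read off from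
  words are multiplied by \<open>Suc K\<close>; then m is a multiple of \<open>Suc K\<close>.

  Structural statements about sets take the form of inequalities between averages, since they must
  be averaged again over surrounding words, nodes and levels. In particular, a partition into
  subspaces is replaced by a bound for test functions whose mean on every subspace is at most
  0.\<close>

definition mean :: "'b set \<Rightarrow> ('b \<Rightarrow> real) \<Rightarrow> real" where
  "mean X f = (\<Sum>x\<in>X. f x) / real (card X)"

lemma mean_cong: "(\<And>x. x \<in> X \<Longrightarrow> f x = g x) \<Longrightarrow> mean X f = mean X g"
  by (simp add: mean_def)

lemma mean_add: "mean X (\<lambda>x. f x + g x) = mean X f + mean X g"
  by (simp add: mean_def sum.distrib add_divide_distrib)

lemma mean_diff: "mean X (\<lambda>x. f x - g x) = mean X f - mean X g"
  by (simp add: mean_def sum_subtractf diff_divide_distrib)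

lemma mean_cmult: "mean X (\<lambda>x. c * f x) = c * mean X f"
  by (simp add: mean_def sum_distrib_left)

lemma mean_divide: "mean X (\<lambda>x. f x / c) = mean X f / c"
  by (simp add: mean_def sum_divide_distrib mult.commute)

lemma mean_sum: "mean X (\<lambda>x. \<Sum>i\<in>I. f i x) = (\<Sum>i\<in>I. mean X (f i))"
  unfolding mean_def by (subst sum.swap) (simp add: sum_divide_distrib)

lemma mean_const: "finite X \<Longrightarrow> X \<noteq> {} \<Longrightarrow> mean X (\<lambda>x. c) = c"
  by (simp add: mean_def)

lemma mean_mono: "(\<And>x. x \<in> X \<Longrightarrow> f x \<le> g x) \<Longrightarrow> mean X f \<le> mean X g"
  unfolding mean_def by (intro divide_right_mono sum_mono) auto

lemma mean_nonneg: "(\<And>x. x \<in> X \<Longrightarrow> 0 \<le> f x) \<Longrightarrow> 0 \<le> mean X f"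
  unfolding mean_def by (intro divide_nonneg_nonneg sum_nonneg) auto

lemma mean_le:
  assumes "finite X" "X \<noteq> {}" "\<And>x. x \<in> X \<Longrightarrow> f x \<le> c"
  shows "mean X f \<le> c"
  using mean_mono[of X f "\<lambda>_. c"] assms by (simp add: mean_const)

lemma mean_ge:
  assumes "finite X" "X \<noteq> {}" "\<And>x. x \<in> X \<Longrightarrow> c \<le> f x"
  shows "c \<le> mean X f"
  using mean_mono[of X "\<lambda>_. c" f] assms by (simp add: mean_const)

lemma mean_le_imp_ex:
  assumes "finite X" "X \<noteq> {}" "c \<le> mean X f"
  shows "\<exists>x\<in>X. c \<le> f x"
proof (rule ccontr)
  assume "\<not> ?thesis"
  then have "(\<Sum>x\<in>X. f x) < (\<Sum>x\<in>X. c)"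
    using assms by (intro sum_strict_mono) auto
  then have "mean X f < c"
    using assms by (auto simp: mean_def field_simps card_gt_0_iff)
  with assms show False by simp
qed

lemma mean_swap: "mean X (\<lambda>x. mean Y (\<lambda>y. f x y)) = mean Y (\<lambda>y. mean X (\<lambda>x. f x y))"
proof -
  have "(\<Sum>x\<in>X. \<Sum>y\<in>Y. f x y) = (\<Sum>y\<in>Y. \<Sum>x\<in>X. f x y)" by (rule sum.swap)
  then show ?thesis
    by (simp add: mean_def sum_divide_distrib[symmetric])
qed

lemma mean_bij:
  assumes "bij_betw h X Y"
  shows "mean Y f = mean X (\<lambda>x. f (h x))"
  using assms by (simp add: mean_def sum.reindex_bij_betw bij_betw_same_card)

lemma mean_Times: "mean (X \<times> Y) f = mean X (\<lambda>x. mean Y (\<lambda>y. f (x, y)))"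
proof -
  have "sum f (X \<times> Y) = (\<Sum>x\<in>X. \<Sum>y\<in>Y. f (x, y))"
    by (simp add: sum.cartesian_product)
  then show ?thesis
    by (simp add: mean_def card_cartesian_product sum_divide_distrib[symmetric] mult.commute)
qed

lemma mean_singleton [simp]: "mean {x} f = f x"
  by (simp add: mean_def)

lemma mean_variance:
  assumes "finite X" "X \<noteq> {}"
  shows "mean X (\<lambda>x. (f x - mean X f)\<^sup>2) = mean X (\<lambda>x. (f x)\<^sup>2) - (mean X f)\<^sup>2"
proof -
  let ?m = "mean X f"
  have "mean X (\<lambda>x. (f x - ?m)\<^sup>2) = mean X (\<lambda>x. (f x)\<^sup>2 - ((2 * ?m) * f x - ?m\<^sup>2))"
    by (rule mean_cong) (simp add: power2_eq_square algebra_simps)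
  also have "\<dots> = mean X (\<lambda>x. (f x)\<^sup>2) - ((2 * ?m) * ?m - ?m\<^sup>2)"
    using assms by (simp add: mean_diff mean_cmult mean_const)
  finally show ?thesis by (simp add: power2_eq_square)
qed

section \<open>Words of fixed length, averaged block by block\<close>

definition words :: "'b set \<Rightarrow> nat \<Rightarrow> 'b list set" where
  "words S n = {w. set w \<subseteq> S \<and> length w = n}"

lemma finite_words [simp]: "finite S \<Longrightarrow> finite (words S n)"
  unfolding words_def by (rule finite_lists_length_eq)

lemma card_words: "finite S \<Longrightarrow> card (words S n) = card S ^ n"
  unfolding words_def by (rule card_lists_length_eq)

lemma words_eq_empty_iff [simp]: "words S n = {} \<longleftrightarrow> S = {} \<and> n > 0"
proof
  assume e: "words S n = {}"
  have "S = {}"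
  proof (rule ccontr)
    assume "S \<noteq> {}"
    then obtain a where "a \<in> S" by auto
    then have "replicate n a \<in> words S n" by (auto simp: words_def)
    with e show False by simp
  qed
  moreover have "[] \<in> words S 0" by (simp add: words_def)
  ultimately show "S = {} \<and> n > 0" using e by (cases n) auto
qed (auto simp: words_def)

lemma words_0 [simp]: "words S 0 = {[]}"
  by (auto simp: words_def)

lemma length_words: "x \<in> words S a \<Longrightarrow> length x = a"
  by (simp add: words_def)

lemma bij_betw_words_append:
  "bij_betw (\<lambda>(x, y). x @ y) (words S a \<times> words S b) (words S (a + b))"
proof (rule bij_betw_byWitness[where f' = "\<lambda>w. (take a w, drop a w)"])
  show "(\<lambda>w. (take a w, drop a w)) ` words S (a + b) \<subseteq> words S a \<times> words S b"
    by (auto simp: words_def dest: in_set_takeD in_set_dropD)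
qed (auto simp: words_def)

lemma mean_words_add:
  "mean (words S (a + b)) f = mean (words S a) (\<lambda>x. mean (words S b) (\<lambda>y. f (x @ y)))"
  by (simp add: mean_bij[OF bij_betw_words_append] mean_Times case_prod_unfold)

lemma mean_words_add':
  "mean (words S (a + b)) f = mean (words S b) (\<lambda>y. mean (words S a) (\<lambda>x. f (x @ y)))"
  by (subst mean_words_add) (rule mean_swap)

lemma mean_words_lessThan_const [simp]: "(q::nat) > 0 \<Longrightarrow> mean (words {..<q} n) (\<lambda>_. c) = c"
  by (rule mean_const) auto

section \<open>A block regularity lemma\<close>

lemma mean_words_of_bool_eq:
  assumes "finite S" "z \<in> words S M"
  shows "mean (words S M) (\<lambda>v. g v * of_bool (v = z)) = g z / real (card S ^ M)"
proof -
  have "(\<Sum>v\<in>words S M. g v * of_bool (v = z)) = (\<Sum>v\<in>words S M. if v = z then g v else 0)"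
    by (rule sum.cong) auto
  then show ?thesis using assms by (simp add: mean_def card_words)
qed

text \<open>For a uniformly random word the blocks are independent, and p is the probability that
  block t equals \<open>z t\<close>. The summands are therefore centred with variance
  \<open>p - p\<^sup>2\<close>, and variances add; the induction splits off the last block.\<close>

lemma block_second_moment:
  fixes S :: "'b set"
  assumes S: "finite S" "S \<noteq> {}" and z: "\<And>t::nat. z t \<in> words S M"
  defines "p \<equiv> 1 / real (card S ^ M)"
  shows "mean (words S (T * M))
    (\<lambda>w. (\<Sum>t<T. p - of_bool (take M (drop (t * M) w) = z t))\<^sup>2) \<le> real T * p"
proof (induction T)
  case 0
  then show ?case by simp
next
  case (Suc T)
  let ?H = "\<lambda>T w. \<Sum>t<T. p - of_bool (take M (drop (t * M) w) = z t)"
  have cS: "card S > 0" using S by (simp add: card_gt_0_iff)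
  have m1: "mean (words S M) (\<lambda>v. of_bool (v = z T)) = p"
    using mean_words_of_bool_eq[OF S(1) z, of "\<lambda>_. 1" T] by (simp add: p_def)
  have H: "?H (Suc T) (w @ v) = ?H T w + (p - of_bool (v = z T))"
    if w: "w \<in> words S (T * M)" and v: "v \<in> words S M" for w v
  proof -
    have "take M (drop (t * M) (w @ v)) = take M (drop (t * M) w)" if "t < T" for t
    proof -
      have "Suc t * M \<le> T * M" using that by (intro mult_right_mono) auto
      then have "t * M + M \<le> length w" using w by (simp add: length_words)
      then show ?thesis by simp
    qed
    moreover have "take M (drop (T * M) (w @ v)) = v"
      using w v by (simp add: length_words)
    ultimately show ?thesis
      by (simp del: take_append drop_append cong: sum.cong_simp)
  qed
  have inner: "mean (words S M) (\<lambda>v. (?H (Suc T) (w @ v))\<^sup>2) \<le> (?H T w)\<^sup>2 + p"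
    if w: "w \<in> words S (T * M)" for w
  proof -
    let ?A = "?H T w"
    have "mean (words S M) (\<lambda>v. (?H (Suc T) (w @ v))\<^sup>2)
      = mean (words S M) (\<lambda>v. (?A + p)\<^sup>2 - (2 * (?A + p) - 1) * of_bool (v = z T))"
      using w by (intro mean_cong, subst H) (auto simp: power2_eq_square algebra_simps)
    also have "\<dots> = (?A + p)\<^sup>2 - (2 * (?A + p) - 1) * p"
      unfolding mean_diff mean_cmult m1 using S by (subst mean_const) auto
    also have "\<dots> = ?A\<^sup>2 + p - p\<^sup>2" by (simp add: power2_eq_square algebra_simps)
    finally show ?thesis by simp
  qed
  have "mean (words S (Suc T * M)) (\<lambda>w. (?H (Suc T) w)\<^sup>2)
     = mean (words S (T * M)) (\<lambda>w. mean (words S M) (\<lambda>v. (?H (Suc T) (w @ v))\<^sup>2))"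
    by (subst mean_words_add[symmetric]) (simp add: add.commute)
  also have "\<dots> \<le> mean (words S (T * M)) (\<lambda>w. (?H T w)\<^sup>2 + p)"
    by (rule mean_mono) (rule inner)
  also have "\<dots> = mean (words S (T * M)) (\<lambda>w. (?H T w)\<^sup>2) + p"
    using S by (simp add: mean_add mean_const)
  also have "\<dots> \<le> real T * p + p" using Suc.IH by simp
  finally show ?case by (simp add: algebra_simps)
qed

text \<open>If every block had an exceptional value, the normalised number of exceptional blocks would
  correlate with \<open>f\<close> more than its variance permits.\<close>

lemma block_regularity:
  fixes S :: "'b set"
  assumes S: "finite S" "S \<noteq> {}" and \<epsilon>: "\<epsilon> > 0"
  shows "\<exists>n. \<forall>f. (\<forall>w. 0 \<le> f w \<and> f w \<le> 1) \<longrightarrow> (\<exists>a b. a + M + b = n \<and>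
    (\<forall>z\<in>words S M. mean (words S n) f - \<epsilon>
      \<le> mean (words S a) (\<lambda>x. mean (words S b) (\<lambda>y. f (x @ z @ y)))))"
proof -
  define p where "p = 1 / real (card S ^ M)"
  have cS: "card S > 0" using S by (simp add: card_gt_0_iff)
  have p: "p > 0" unfolding p_def using cS by simp
  \<comment> \<open>The correlation found below would force
    \<open>(T * p * \<epsilon>)\<^sup>2 \<le> T * p\<close>, that is
    \<open>T * p * \<epsilon>\<^sup>2 \<le> 1\<close>; this T rules that out.\<close>
  obtain T where T: "1 / (p * \<epsilon>\<^sup>2) < real T" using reals_Archimedean2 by blast
  have T0: "real T > 0" using T p \<epsilon> by (smt (verit) divide_pos_pos zero_less_mult_iff zero_less_power)
  show ?thesis
  proof (rule exI[of _ "T * M"], intro allI impI, rule ccontr)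
    fix f :: "'b list \<Rightarrow> real"
    assume f: "\<forall>w. 0 \<le> f w \<and> f w \<le> 1"
    let ?E = "mean (words S (T * M)) f"
    let ?F = "\<lambda>t z. mean (words S (t * M)) (\<lambda>x. mean (words S ((T - Suc t) * M)) (\<lambda>y. f (x @ z @ y)))"
    assume no: "\<not> (\<exists>a b. a + M + b = T * M \<and>
      (\<forall>z\<in>words S M. ?E - \<epsilon> \<le> mean (words S a) (\<lambda>x. mean (words S b) (\<lambda>y. f (x @ z @ y)))))"
    have split: "t * M + M + (T - Suc t) * M = T * M" if "t < T" for t
      using that by (metis Suc_leI add_mult_distrib le_add_diff_inverse mult_Suc add.commute)
    have "\<exists>z. z \<in> words S M \<and> (t < T \<longrightarrow> ?F t z < ?E - \<epsilon>)" for t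
    proof (cases "t < T")
      case True
      with no split[OF True] show ?thesis by (meson not_le)
    next
      case False
      then show ?thesis using S words_eq_empty_iff[of S M] by blast
    qed
    then obtain z where z: "\<And>t. z t \<in> words S M" and zF: "\<And>t. t < T \<Longrightarrow> ?F t (z t) < ?E - \<epsilon>"
      by metis
    let ?X = "\<lambda>w. \<Sum>t<T. p - of_bool (take M (drop (t * M) w) = z t)"
    \<comment> \<open>Block t equals \<open>z t\<close> with probability p, and given this event f
      has average \<open>?F t (z t)\<close>.\<close>
    have first: "mean (words S (T * M)) (\<lambda>w. f w * of_bool (take M (drop (t * M) w) = z t))
      = p * ?F t (z t)" if t: "t < T" for t
    proof -
      let ?b = "(T - Suc t) * M"
      let ?g = "\<lambda>w. f w * of_bool (take M (drop (t * M) w) = z t)"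
      have "mean (words S (T * M)) ?g = mean (words S (t * M)) (\<lambda>x. mean (words S ?b)
        (\<lambda>y. mean (words S M) (\<lambda>v. ?g (x @ v @ y))))"
        unfolding split[OF t, symmetric] add.assoc
        by (subst mean_words_add, rule mean_cong, rule mean_words_add'[THEN trans]) simp
      also have "\<dots> = mean (words S (t * M)) (\<lambda>x. mean (words S ?b)
        (\<lambda>y. mean (words S M) (\<lambda>v. f (x @ v @ y) * of_bool (v = z t))))"
        by (intro mean_cong) (auto dest!: length_words)
      also have "\<dots> = mean (words S (t * M)) (\<lambda>x. mean (words S ?b) (\<lambda>y. p * f (x @ z t @ y)))"
        by (intro mean_cong) (simp add: mean_words_of_bool_eq[OF S(1) z] p_def)
      finally show ?thesis by (simp add: mean_cmult)
    qed
    have "mean (words S (T * M)) (\<lambda>w. f w * ?X w)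
      = (\<Sum>t<T. mean (words S (T * M)) (\<lambda>w. p * f w - f w * of_bool (take M (drop (t * M) w) = z t)))"
      unfolding mean_sum[symmetric]
      by (intro mean_cong) (simp add: sum_distrib_left algebra_simps)
    also have "\<dots> = (\<Sum>t<T. p * (?E - ?F t (z t)))"
      by (intro sum.cong refl, subst mean_diff, subst first) (auto simp: mean_cmult right_diff_distrib)
    also have "\<dots> \<ge> (\<Sum>t<T. p * \<epsilon>)"
    proof (intro sum_mono mult_left_mono)
      fix t assume "t \<in> {..<T}"
      then show "\<epsilon> \<le> ?E - ?F t (z t)" using zF[of t] by simp
    qed (use p in simp)
    finally have low: "real T * p * \<epsilon> \<le> mean (words S (T * M)) (\<lambda>w. f w * ?X w)" by simp
    define l where "l = real T * p * \<epsilon>"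
    have l: "l > 0" using T0 p \<epsilon> by (simp add: l_def)
    \<comment> \<open>This stands in for Cauchy--Schwarz. As l is the lower bound for the
      correlation, the term \<open>l / 2\<close> is absorbed and \<open>l * l \<le> T * p\<close>
      remains.\<close>
    have amgm: "f w * ?X w \<le> l / 2 + (1 / (2 * l)) * (?X w)\<^sup>2" for w
    proof -
      have "f w * ?X w \<le> \<bar>?X w\<bar>"
        using f by (smt (verit) mult_left_le_one_le mult_nonneg_nonpos)
      moreover have "0 \<le> (\<bar>?X w\<bar> - l)\<^sup>2" by simp
      then have "2 * l * \<bar>?X w\<bar> \<le> l\<^sup>2 + (?X w)\<^sup>2" by (simp add: power2_diff mult_ac)
      then have "\<bar>?X w\<bar> \<le> l / 2 + (1 / (2 * l)) * (?X w)\<^sup>2"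
        using l by (simp add: field_simps power2_eq_square)
      ultimately show ?thesis by linarith
    qed
    have "l \<le> mean (words S (T * M)) (\<lambda>w. l / 2 + (1 / (2 * l)) * (?X w)\<^sup>2)"
      using low unfolding l_def[symmetric] by (rule order_trans) (rule mean_mono, rule amgm)
    also have "\<dots> = l / 2 + (1 / (2 * l)) * mean (words S (T * M)) (\<lambda>w. (?X w)\<^sup>2)"
      using S by (simp only: mean_add mean_cmult) (simp add: mean_const)
    also have "\<dots> \<le> l / 2 + (1 / (2 * l)) * (real T * p)"
      using block_second_moment[OF S z, of T] l unfolding p_def[symmetric]
      by (intro add_left_mono mult_left_mono) auto
    finally have "l * l \<le> real T * p" using l by (simp add: field_simps)
    then have "(real T * p) * (real T * (p * \<epsilon>\<^sup>2)) \<le> (real T * p) * 1"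
      by (simp add: l_def power2_eq_square mult_ac)
    then have "real T * (p * \<epsilon>\<^sup>2) \<le> 1" using mult_pos_pos[OF T0 p] by (simp only: mult_le_cancel_left_pos)
    moreover have "1 < real T * (p * \<epsilon>\<^sup>2)" using T p \<epsilon> by (simp add: field_simps)
    ultimately show False by simp
  qed
qed

section \<open>Lines and subspaces\<close>

text \<open>One operation serves two purposes: for a line over [k] the letter k is the variable,
  which receives the value i; over [k + 1] the letter k is a genuine letter that is identified with
  i.\<close>

definition rep :: "nat \<Rightarrow> nat \<Rightarrow> nat list \<Rightarrow> nat list" where
  "rep k i w = map (\<lambda>c. if c = k then i else c) w"

lemma rep_append [simp]: "rep k i (x @ y) = rep k i x @ rep k i y"
  by (simp add: rep_def)

lemma rep_Cons [simp]: "rep k i (c # w) = (if c = k then i else c) # rep k i w"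
  by (simp add: rep_def)

lemma length_rep [simp]: "length (rep k i w) = length w"
  by (simp add: rep_def)

lemma rep_rep [simp]: "rep k i (rep k i w) = rep k i w"
  by (simp add: rep_def)

lemma rep_words: "i < k \<Longrightarrow> w \<in> words {..k} n \<Longrightarrow> rep k i w \<in> words {..<k} n"
  by (auto simp: rep_def words_def subset_iff)

lemma rep_id: "k \<notin> set w \<Longrightarrow> rep k i w = w"
  by (auto simp: rep_def intro: map_idI)

definition dens :: "nat \<Rightarrow> nat \<Rightarrow> nat list set \<Rightarrow> real" where
  "dens k n A = mean (words {..<k} n) (\<lambda>w. of_bool (w \<in> A))"

lemma dens_le_1: "k > 0 \<Longrightarrow> dens k n A \<le> 1"
  unfolding dens_def by (rule mean_le) auto

text \<open>A combinatorial line of \<open>[k]\<^sup>n\<close> is encoded by a word \<open>l\<close> over \<open>{0..k}\<close> in which the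
  letter \<open>k\<close> occurs and plays the role of the variable.\<close>

definition has_line :: "nat \<Rightarrow> nat \<Rightarrow> nat list set \<Rightarrow> bool" where
  "has_line k n A \<longleftrightarrow> (\<exists>l\<in>words {..k} n. k \<in> set l \<and> (\<forall>i<k. rep k i l \<in> A))"

text \<open>Only one dimension for each \<delta> is asked for; the applications choose a block of
  exactly this length.\<close>

definition dhj :: "nat \<Rightarrow> bool" where
  "dhj k \<longleftrightarrow> (\<forall>\<delta>>0. \<exists>n. \<forall>A. \<delta> \<le> dens k n A \<longrightarrow> has_line k n A)"

text \<open>In a template, \<open>Inl a\<close> is the constant letter \<open>a\<close> and \<open>Inr j\<close> is the \<open>j\<close>-th variable.\<close>

definition sub :: "(nat + nat) list \<Rightarrow> nat list \<Rightarrow> nat list" where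
  "sub t y = map (\<lambda>c. case c of Inl a \<Rightarrow> a | Inr j \<Rightarrow> y ! j) t"

definition letters :: "nat \<Rightarrow> nat \<Rightarrow> (nat + nat) set" where
  "letters k m = Inl ` {..<k} \<union> Inr ` {..<m}"

text \<open>The occurrence of every variable makes \<open>sub t\<close> injective. Words over
  \<open>letters k m\<close> in which variables may be missing occur separately, as random templates
  in \<open>density_increment\<close>.\<close>

definition subspaces :: "nat \<Rightarrow> nat \<Rightarrow> nat \<Rightarrow> (nat + nat) list set" where
  "subspaces k m n = {t \<in> words (letters k m) n. Inr ` {..<m} \<subseteq> set t}"

lemma finite_letters [simp]: "finite (letters k m)"
  by (simp add: letters_def)

lemma subspacesD: "t \<in> subspaces k m n \<Longrightarrow> t \<in> words (letters k m) n"
  by (simp add: subspaces_def)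

lemma sub_append [simp]: "sub (s @ t) y = sub s y @ sub t y"
  by (simp add: sub_def)

lemma sub_Inl [simp]: "sub (map Inl x) y = x"
  by (simp add: sub_def comp_def)

lemma length_sub [simp]: "length (sub t y) = length t"
  by (simp add: sub_def)

lemma sub_words:
  assumes "t \<in> words (letters k m) n" "y \<in> words S m" "{..<k} \<subseteq> S"
  shows "sub t y \<in> words S n"
proof -
  have "(case c of Inl a \<Rightarrow> a | Inr j \<Rightarrow> y ! j) \<in> S" if "c \<in> set t" for c
  proof -
    have "c \<in> letters k m" using that assms(1) by (auto simp: words_def)
    then show ?thesis using assms(2,3) by (auto simp: letters_def words_def subset_iff)
  qed
  then show ?thesis using assms(1) by (auto simp: sub_def words_def)
qed

lemma rep_sub:
  assumes "t \<in> words (letters k m) n" "length y = m"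
  shows "rep k i (sub t y) = sub t (rep k i y)"
proof -
  have "(if (case c of Inl a \<Rightarrow> a | Inr j \<Rightarrow> y ! j) = k then i else (case c of Inl a \<Rightarrow> a | Inr j \<Rightarrow> y ! j))
    = (case c of Inl a \<Rightarrow> a | Inr j \<Rightarrow> rep k i y ! j)" if "c \<in> set t" for c
  proof -
    have "c \<in> letters k m" using that assms(1) by (auto simp: words_def)
    then show ?thesis using assms(2) by (auto simp: letters_def rep_def)
  qed
  then show ?thesis unfolding sub_def rep_def[of k i "map _ _"] map_map comp_def by simp
qed

text \<open>In contrast to \<open>rep_sub\<close>, the template may contain the constant k, which
  \<open>rep k i\<close> changes only after substitution; the outer \<open>rep\<close> makes up for
  this.\<close>

lemma rep_sub_rep:
  assumes "t \<in> words (letters q m) n" "length y = m"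
  shows "rep k i (sub t (rep k i y)) = rep k i (sub t y)"
proof -
  let ?v = "\<lambda>y c. case c of Inl a \<Rightarrow> a | Inr j \<Rightarrow> y ! j"
  have "(if ?v (rep k i y) c = k then i else ?v (rep k i y) c) = (if ?v y c = k then i else ?v y c)"
    if "c \<in> set t" for c
  proof -
    have "c \<in> letters q m" using that assms(1) by (auto simp: words_def)
    then show ?thesis using assms(2) by (auto simp: letters_def rep_def)
  qed
  then show ?thesis unfolding sub_def rep_def[of k i "map _ _"] map_map comp_def by simp
qed

lemma inj_on_sub:
  assumes "t \<in> subspaces k m n"
  shows "inj_on (sub t) (words S m)"
proof (rule inj_onI)
  fix x y assume xy: "x \<in> words S m" "y \<in> words S m" "sub t x = sub t y"
  have "x ! j = y ! j" if "j < m" for j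
  proof -
    have "Inr j \<in> set t" using assms that by (auto simp: subspaces_def)
    with xy(3) show ?thesis unfolding sub_def map_eq_conv by (metis sum.case(2))
  qed
  then show "x = y" using xy(1,2) by (auto simp: words_def intro: nth_equalityI)
qed

lemma subspaces_compose:
  assumes t: "t \<in> subspaces k M n" and s: "s \<in> subspaces k m M"
  shows "\<exists>t'\<in>subspaces k m n. \<forall>y. sub t' y = sub t (sub s y)"
proof
  let ?t' = "map (\<lambda>c. case c of Inl a \<Rightarrow> Inl a | Inr j \<Rightarrow> s ! j) t"
  have ls: "length s = M" using s by (simp add: subspaces_def words_def)
  have c: "c \<in> letters k M" if "c \<in> set t" for c
    using that t by (auto simp: subspaces_def words_def)
  have sl: "s ! j \<in> letters k m" if "j < M" for j
    using that s ls by (auto simp: subspaces_def words_def subset_iff)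
  show "\<forall>y. sub ?t' y = sub t (sub s y)"
  proof
    fix y
    have "(case (case c of Inl a \<Rightarrow> Inl a | Inr j \<Rightarrow> s ! j) of Inl a \<Rightarrow> a | Inr j \<Rightarrow> y ! j)
      = (case c of Inl a \<Rightarrow> a | Inr j \<Rightarrow> map (\<lambda>c. case c of Inl a \<Rightarrow> a | Inr j \<Rightarrow> y ! j) s ! j)"
      if "c \<in> set t" for c
      using c[OF that] ls by (auto simp: letters_def)
    then show "sub ?t' y = sub t (sub s y)"
      unfolding sub_def map_map comp_def by simp
  qed
  have "Inr j \<in> set ?t'" if "j < m" for j
  proof -
    have "Inr j \<in> set s" using s that by (auto simp: subspaces_def)
    then obtain i where "i < M" "s ! i = Inr j" using ls by (auto simp: in_set_conv_nth)
    moreover from this(1) have "Inr i \<in> set t" using t by (auto simp: subspaces_def)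
    ultimately show ?thesis by (force simp: image_iff)
  qed
  moreover have "set ?t' \<subseteq> letters k m"
  proof
    fix d assume "d \<in> set ?t'"
    then obtain c' where c': "c' \<in> set t" "d = (case c' of Inl a \<Rightarrow> Inl a | Inr j \<Rightarrow> s ! j)" by auto
    consider a where "c' = Inl a" "a < k" | j where "c' = Inr j" "j < M"
      using c[OF c'(1)] by (auto simp: letters_def)
    then show "d \<in> letters k m"
    proof cases
      case 1
      then show ?thesis using c'(2) by (simp add: letters_def)
    next
      case 2
      then show ?thesis using c'(2) sl by simp
    qed
  qed
  ultimately show "?t' \<in> subspaces k m n" using t by (auto simp: subspaces_def words_def)
qed

lemma subspaces_surround:
  assumes "t \<in> subspaces k m n" "x \<in> words {..<k} a" "y \<in> words {..<k} b"
  shows "map Inl x @ t @ map Inl y \<in> subspaces k m (a + n + b)"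
  using assms by (auto simp: subspaces_def words_def letters_def)

lemma subspaces_mono: "t \<in> subspaces k m n \<Longrightarrow> k \<le> q \<Longrightarrow> t \<in> subspaces q m n"
  using image_mono[of "{..<k}" "{..<q}" Inl] by (auto simp: subspaces_def words_def letters_def)

text \<open>A pointwise form of the density Hales--Jewett property that can be averaged over
  a family of sets.\<close>

lemma dens_le_sum_lines:
  assumes k: "k > 0" and n: "\<And>A. \<delta> \<le> dens k n A \<Longrightarrow> has_line k n A" and \<delta>: "\<delta> > 0"
  shows "dens k n A \<le> \<delta> + (\<Sum>l | l \<in> words {..k} n \<and> k \<in> set l. of_bool (\<forall>i<k. rep k i l \<in> A))"
proof (cases "\<delta> \<le> dens k n A")
  case True
  then obtain l where l: "l \<in> words {..k} n" "k \<in> set l" "\<forall>i<k. rep k i l \<in> A"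
    using n by (auto simp: has_line_def)
  let ?L = "{l. l \<in> words {..k} n \<and> k \<in> set l}"
  have "(1::real) \<le> (\<Sum>l\<in>?L. of_bool (\<forall>i<k. rep k i l \<in> A))"
    using l by (intro order_trans[OF _ member_le_sum[of l]]) auto
  with dens_le_1[OF k, of n A] \<delta> show ?thesis by simp
next
  case False
  have "(0::real) \<le> (\<Sum>l | l \<in> words {..k} n \<and> k \<in> set l. of_bool (\<forall>i<k. rep k i l \<in> A))"
    by (rule sum_nonneg) simp
  with False show ?thesis by linarith
qed

text \<open>Pigeonhole over the patterns, of which there are at most
  \<open>(k + 1) ^ n\<close>.\<close>

lemma ex_line_of_sum:
  fixes g :: "nat list \<Rightarrow> real"
  assumes "c \<le> (\<Sum>l | l \<in> words {..k} n \<and> k \<in> set l. g l)" "c > 0"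
  shows "\<exists>l\<in>words {..k} n. k \<in> set l \<and> c / real ((k + 1) ^ n) \<le> g l"
proof (rule ccontr)
  assume no: "\<not> ?thesis"
  let ?L = "{l. l \<in> words {..k} n \<and> k \<in> set l}"
  let ?q = "c / real ((k + 1) ^ n)"
  have q: "?q > 0" using assms(2) by simp
  have "card ?L \<le> card (words {..k} n)" by (rule card_mono) auto
  then have card: "card ?L \<le> (k + 1) ^ n" by (simp add: card_words)
  have ne: "?L \<noteq> {}"
  proof
    assume "?L = {}"
    with assms show False by (simp only: sum.empty)
  qed
  have "(\<Sum>l\<in>?L. g l) < (\<Sum>l\<in>?L. ?q)"
    using no ne by (intro sum_strict_mono) auto
  also have "\<dots> = real (card ?L) * ?q" by simp
  also have "\<dots> \<le> real ((k + 1) ^ n) * ?q"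
    using card q by (intro mult_right_mono) (auto simp del: of_nat_power)
  also have "\<dots> = c" by simp
  finally show False using assms(1) by simp
qed

text \<open>Averaging \<open>dens_le_sum_lines\<close> over the last n2 letters yields a single line
  l in the first block that stays in A for a dense set of continuations. The induction hypothesis
  finds a subspace of such continuations, and the variable of l becomes variable 0.\<close>

lemma multidimensional_dhj:
  assumes k: "k > 0" and "dhj k"
  shows "\<delta> > 0 \<Longrightarrow> \<exists>n. \<forall>A. \<delta> \<le> dens k n A \<longrightarrow> (\<exists>t\<in>subspaces k m n. \<forall>y\<in>words {..<k} m. sub t y \<in> A)"
proof (induction m arbitrary: \<delta>)
  case 0
  have "[] \<in> A" if "\<delta> \<le> dens k 0 A" for A
    using that 0 by (cases "[] \<in> A") (auto simp: dens_def)
  then show ?case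
    by (intro exI[of _ 0] allI impI bexI[of _ "[]"]) (auto simp: subspaces_def sub_def)
next
  case (Suc m)
  obtain n1 where n1: "\<And>A. \<delta> / 2 \<le> dens k n1 A \<Longrightarrow> has_line k n1 A"
    using \<open>dhj k\<close> Suc.prems unfolding dhj_def by (meson half_gt_zero)
  let ?q = "(\<delta> / 2) / real ((k + 1) ^ n1)"
  have "?q > 0" using Suc.prems by simp
  from Suc.IH[OF this] obtain n2 where n2: "\<And>A. ?q \<le> dens k n2 A \<Longrightarrow>
    \<exists>t\<in>subspaces k m n2. \<forall>y\<in>words {..<k} m. sub t y \<in> A" by blast
  show ?case
  proof (intro exI[of _ "n1 + n2"] allI impI)
    fix A assume A: "\<delta> \<le> dens k (n1 + n2) A"
    let ?B = "\<lambda>l. {w. \<forall>i<k. rep k i l @ w \<in> A}"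
    have "dens k (n1 + n2) A = mean (words {..<k} n2) (\<lambda>w. dens k n1 {z. z @ w \<in> A})"
      unfolding dens_def mean_words_add' by simp
    also have "\<dots> \<le> mean (words {..<k} n2) (\<lambda>w. \<delta> / 2 +
      (\<Sum>l | l \<in> words {..k} n1 \<and> k \<in> set l. of_bool (w \<in> ?B l)))"
      using dens_le_sum_lines[OF k n1, of _ "{z. z @ w \<in> A}" for w] Suc.prems
      by (intro mean_mono) simp
    also have "\<dots> = \<delta> / 2 + (\<Sum>l | l \<in> words {..k} n1 \<and> k \<in> set l. dens k n2 (?B l))"
      unfolding mean_add mean_sum dens_def using k by (subst mean_const) auto
    finally have "\<delta> / 2 \<le> (\<Sum>l | l \<in> words {..k} n1 \<and> k \<in> set l. dens k n2 (?B l))"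
      using A by linarith
    from ex_line_of_sum[OF this] Suc.prems obtain l where
      l: "l \<in> words {..k} n1" "k \<in> set l" "?q \<le> dens k n2 (?B l)" by auto
    obtain t where t: "t \<in> subspaces k m n2" "\<forall>y\<in>words {..<k} m. sub t y \<in> ?B l"
      using n2[OF l(3)] by blast
    let ?l = "map (\<lambda>c. if c = k then Inr 0 else Inl c) l :: (nat + nat) list"
    let ?t = "map (\<lambda>c. case c of Inl a \<Rightarrow> Inl a | Inr j \<Rightarrow> Inr (Suc j)) t :: (nat + nat) list"
    have "sub (?l @ ?t) y \<in> A" if y: "y \<in> words {..<k} (Suc m)" for y
    proof -
      obtain i y' where iy: "y = i # y'" "i < k" "y' \<in> words {..<k} m"
        using y by (cases y) (auto simp: words_def)
      have "sub ?l y = rep k i l" using iy(1) by (simp add: sub_def rep_def)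
      moreover have "sub ?t y = sub t y'"
        using iy(1) by (auto simp: sub_def split: sum.splits)
      ultimately show ?thesis using t(2) iy by simp
    qed
    moreover have "?l @ ?t \<in> subspaces k (Suc m) (n1 + n2)"
    proof -
      have "set ?l \<subseteq> letters k (Suc m)"
        using l(1) by (auto simp: words_def letters_def)
      moreover have "set ?t \<subseteq> letters k (Suc m)"
        using t(1) by (auto simp: words_def letters_def subspaces_def)
      moreover have "Inr j \<in> set (?l @ ?t)" if "j < Suc m" for j
      proof (cases j)
        case 0
        then show ?thesis using l(2) by (auto simp: image_iff)
      next
        case (Suc j')
        then have "Inr j' \<in> set t" using t(1) that by (auto simp: subspaces_def)
        then show ?thesis using Suc by (force simp: image_iff)
      qed
      ultimately show ?thesis using l(1) t(1)
        by (auto simp: subspaces_def words_def)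
    qed
    ultimately show "\<exists>t\<in>subspaces k (Suc m) (n1 + n2). \<forall>y\<in>words {..<k} (Suc m). sub t y \<in> A"
      by blast
  qed
qed

section \<open>Insensitive sets\<close>

text \<open>Equivalently, membership does not change when letters i and k are exchanged at arbitrary
  positions.\<close>

definition insensitive :: "nat \<Rightarrow> nat \<Rightarrow> nat list set \<Rightarrow> bool" where
  "insensitive k i D \<longleftrightarrow> (\<forall>w. rep k i w \<in> D \<longleftrightarrow> w \<in> D)"

text \<open>The length condition keeps the evaluations \<open>y ! j\<close> inside y, as
  \<open>rep_sub_rep\<close> requires.\<close>

lemma insensitive_preimage:
  assumes D: "insensitive k i D" and t: "t \<in> words (letters q m) n"
  shows "insensitive k i {y. length y = m \<and> sub t y \<in> D}"
  using rep_sub_rep[OF t, of _ k i] D unfolding insensitive_def by auto metis+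

lemma insensitive_append:
  assumes "insensitive k i D"
  shows "x @ rep k i y \<in> D \<longleftrightarrow> x @ y \<in> D" "rep k i x @ y \<in> D \<longleftrightarrow> x @ y \<in> D"
  using assms unfolding insensitive_def by (metis rep_append rep_rep)+

text \<open>Block regularity makes the restriction of \<open>D\<close> to \<open>[k]\<^sup>n\<close> dense in a suitable block, and
  insensitivity extends a subspace over \<open>[k]\<close> to one over \<open>[k + 1]\<close>.\<close>

lemma dense_insensitive_contains_subspace:
  assumes k: "k > 0" and dhj: "dhj k" and i: "i < k" and \<beta>: "\<beta> > 0"
  shows "\<exists>n. \<forall>D. insensitive k i D \<longrightarrow> \<beta> \<le> dens (Suc k) n D \<longrightarrow>
    (\<exists>t\<in>subspaces (Suc k) m n. \<forall>y\<in>words {..<Suc k} m. sub t y \<in> D)"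
proof -
  obtain n0 where n0: "\<And>A. \<beta> / 2 \<le> dens k n0 A \<Longrightarrow>
      \<exists>t\<in>subspaces k m n0. \<forall>y\<in>words {..<k} m. sub t y \<in> A"
    using multidimensional_dhj[OF k dhj, of "\<beta> / 2" m] \<beta> by auto
  obtain N where N: "\<And>f. (\<And>w. 0 \<le> f w \<and> f w \<le> 1) \<Longrightarrow> \<exists>a b. a + n0 + b = N \<and>
      (\<forall>z\<in>words {..<Suc k} n0. mean (words {..<Suc k} N) f - \<beta> / 2
        \<le> mean (words {..<Suc k} a) (\<lambda>x. mean (words {..<Suc k} b) (\<lambda>y. f (x @ z @ y))))"
    using block_regularity[OF finite_lessThan _ half_gt_zero[OF \<beta>], of "Suc k" n0]
    by (metis lessThan_empty_iff nat.distinct(1))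
  show ?thesis
  proof (intro exI[of _ N] allI impI)
    fix D assume D: "insensitive k i D" and dD: "\<beta> \<le> dens (Suc k) N D"
    let ?f = "\<lambda>w. of_bool (w \<in> D) :: real"
    obtain a b where ab: "a + n0 + b = N" and reg: "\<And>z. z \<in> words {..<Suc k} n0 \<Longrightarrow> dens (Suc k) N D - \<beta> / 2
        \<le> mean (words {..<Suc k} a) (\<lambda>x. mean (words {..<Suc k} b) (\<lambda>y. ?f (x @ z @ y)))"
      using N[of ?f] unfolding dens_def by auto
    \<comment> \<open>The words over [k] may be a tiny fraction of the block, so a bound for most z
      would say nothing about them. This is why regularity has to hold for every z.\<close>
    have "\<beta> / 2 \<le> mean (words {..<k} n0) (\<lambda>z. mean (words {..<Suc k} a)
      (\<lambda>x. mean (words {..<Suc k} b) (\<lambda>y. ?f (x @ z @ y))))"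
    proof (rule mean_ge)
      fix z assume "z \<in> words {..<k} n0"
      then have "z \<in> words {..<Suc k} n0" by (auto simp: words_def)
      from reg[OF this] dD show "\<beta> / 2 \<le> mean (words {..<Suc k} a)
        (\<lambda>x. mean (words {..<Suc k} b) (\<lambda>y. ?f (x @ z @ y)))" by simp
    qed (use k in auto)
    also have "\<dots> = mean (words {..<Suc k} a) (\<lambda>x. mean (words {..<Suc k} b)
      (\<lambda>y. dens k n0 {z. x @ z @ y \<in> D}))"
      unfolding dens_def by (subst mean_swap, rule mean_cong, subst mean_swap) simp
    finally obtain x where x: "x \<in> words {..<Suc k} a" "\<beta> / 2 \<le> mean (words {..<Suc k} b)
      (\<lambda>y. dens k n0 {z. x @ z @ y \<in> D})"
      using mean_le_imp_ex by (metis (no_types, lifting) finite_lessThan finite_words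
          lessThan_empty_iff nat.distinct(1) words_eq_empty_iff)
    then obtain y where y: "y \<in> words {..<Suc k} b" "\<beta> / 2 \<le> dens k n0 {z. x @ z @ y \<in> D}"
      using mean_le_imp_ex by (metis (no_types, lifting) finite_lessThan finite_words
          lessThan_empty_iff nat.distinct(1) words_eq_empty_iff)
    obtain t where t: "t \<in> subspaces k m n0" "\<forall>v\<in>words {..<k} m. x @ sub t v @ y \<in> D"
      using n0[OF y(2)] by auto
    let ?t = "map Inl x @ t @ map Inl y"
    have "?t \<in> subspaces (Suc k) m N"
      using subspaces_surround[OF subspaces_mono[OF t(1)] x(1) y(1)] ab by auto
    moreover have "sub ?t v \<in> D" if v: "v \<in> words {..<Suc k} m" for v
    proof -
      have "v \<in> words {..k} m" using v by (simp add: lessThan_Suc_atMost)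
      from rep_words[OF i this] have "x @ sub t (rep k i v) @ y \<in> D" using t(2) by blast
      then have "x @ rep k i (sub t v) @ y \<in> D"
        using rep_sub[OF subspacesD[OF t(1)] length_words[OF v]] by simp
      then have "x @ sub t v @ y \<in> D"
        using D unfolding insensitive_def by (metis rep_append rep_rep)
      then show ?thesis by simp
    qed
    ultimately show "\<exists>t\<in>subspaces (Suc k) m N. \<forall>y\<in>words {..<Suc k} m. sub t y \<in> D" by blast
  qed
qed

lemma mean_subspace_of_bool:
  assumes t: "t \<in> subspaces q m n" and q: "q > 0"
  shows "mean (words {..<q} n) (\<lambda>z. g z * of_bool (z \<in> sub t ` words {..<q} m))
    = real (q ^ m) / real (q ^ n) * mean (words {..<q} m) (\<lambda>y. g (sub t y))"
proof -
  have "sub t ` words {..<q} m \<subseteq> words {..<q} n"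
    using sub_words[OF subspacesD[OF t], of _ "{..<q}"] by auto
  then have "(\<Sum>z\<in>words {..<q} n. g z * of_bool (z \<in> sub t ` words {..<q} m))
    = (\<Sum>z\<in>sub t ` words {..<q} m. g z)"
    by (intro sum.mono_neutral_cong_right) auto
  also have "\<dots> = (\<Sum>y\<in>words {..<q} m. g (sub t y))"
    using sum.reindex[OF inj_on_sub[OF t, of "{..<q}"], of g] by simp
  finally show ?thesis using q by (simp add: mean_def card_words)
qed

text \<open>The bound is affine in the density of \<open>D\<close>, so that it can be averaged over the first block.\<close>

lemma insensitive_blocks_bound:
  fixes k i m N0 :: nat and \<beta> :: real
  defines "q \<equiv> Suc k"
  defines "c \<equiv> real (q ^ m) / real (q ^ N0)"
  assumes N0: "\<And>D. insensitive k i D \<Longrightarrow> \<beta> \<le> dens q N0 D \<Longrightarrow>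
      \<exists>t\<in>subspaces q m N0. \<forall>y\<in>words {..<q} m. sub t y \<in> D"
    and c1: "c \<le> 1" and \<beta>: "\<beta> > 0"
  shows "(\<And>w. f w \<le> 1) \<Longrightarrow> insensitive k i D \<Longrightarrow>
    (\<And>t. t \<in> subspaces q m (T * N0) \<Longrightarrow> mean (words {..<q} m) (\<lambda>y. f (sub t y)) \<le> 0) \<Longrightarrow>
    mean (words {..<q} (T * N0)) (\<lambda>w. f w * of_bool (w \<in> D))
      \<le> \<beta> + (1 - c) ^ T * (dens q (T * N0) D - \<beta>)"
proof (induction T arbitrary: f D)
  case 0
  then show ?case by (simp add: dens_def)
next
  case (Suc T)
  note f = Suc.prems(1) and D = Suc.prems(2) and sp = Suc.prems(3)
  have q: "q > 0" by (simp add: q_def)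
  have c0: "c \<ge> 0" by (simp add: c_def)
  let ?W = "words {..<q}"
  have fin: "finite (?W n)" and ne: "?W n \<noteq> {}" for n using q by auto
  \<comment> \<open>Above each suffix w whose slice \<open>Dw w\<close> is dense, one subspace is
    removed from the slice. What remains of D is insensitive only in w, so the induction hypothesis
    is applied to the remaining blocks with the first block z fixed.\<close>
  define Dw where "Dw w = {z. z @ w \<in> D}" for w
  define P where "P w \<longleftrightarrow> \<beta> \<le> dens q N0 (Dw w)" for w
  have Dw_ins: "insensitive k i (Dw w)" for w
    using insensitive_append[OF D] unfolding Dw_def insensitive_def by simp
  have Dw_rep: "Dw (rep k i w) = Dw w" for w
    using insensitive_append[OF D] unfolding Dw_def by simp
  have "\<forall>w. \<exists>t. P w \<longrightarrow> t \<in> subspaces q m N0 \<and> (\<forall>y\<in>?W m. sub t y \<in> Dw w)"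
    using N0[OF Dw_ins] unfolding P_def by blast
  then obtain tt where tt: "\<And>w. P w \<Longrightarrow> tt w \<in> subspaces q m N0"
      "\<And>w y. P w \<Longrightarrow> y \<in> ?W m \<Longrightarrow> sub (tt w) y \<in> Dw w" by metis
  \<comment> \<open>The chosen subspace must not depend on the difference between the letters i and
    k in w, since otherwise the remainder \<open>D' z\<close> would lose its insensitivity.\<close>
  define t where "t w = tt (rep k i w)" for w
  have P_rep: "P (rep k i w) = P w" for w unfolding P_def Dw_rep ..
  have t_sub: "t w \<in> subspaces q m N0" if "P w" for w
    using tt(1)[of "rep k i w"] that P_rep by (simp add: t_def)
  have t_Dw: "sub (t w) y \<in> Dw w" if "P w" "y \<in> ?W m" for w y
    using tt(2)[of "rep k i w" y] that P_rep Dw_rep by (simp add: t_def)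
  define R where "R z w \<longleftrightarrow> P w \<and> z \<in> sub (t w) ` ?W m" for z w
  have R_D: "z @ w \<in> D" if "R z w" for z w
    using that t_Dw unfolding R_def Dw_def by auto
  define D' where "D' z = {w. z @ w \<in> D \<and> \<not> R z w}" for z
  have D'_ins: "insensitive k i (D' z)" for z
    using insensitive_append[OF D] unfolding insensitive_def D'_def R_def by (simp add: P_rep t_def)
  have R_mean: "mean (?W N0) (\<lambda>z. g z * of_bool (R z w))
    = (if P w then c * mean (?W m) (\<lambda>y. g (sub (t w) y)) else 0)" for g w
    using mean_subspace_of_bool[OF t_sub q, of w g] fin ne
    by (auto simp: R_def c_def mean_const)
  \<comment> \<open>Followed by the constant letters of w, \<open>t w\<close> is a subspace of the
    whole cube, to which \<open>sp\<close> applies.\<close>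
  have R_le: "mean (?W N0) (\<lambda>z. f (z @ w) * of_bool (R z w)) \<le> 0" if w: "w \<in> ?W (T * N0)" for w
  proof (cases "P w")
    case True
    have "[] @ t w @ map Inl w \<in> subspaces q m (0 + N0 + T * N0)"
      using subspaces_surround[OF t_sub[OF True] _ w, of "[]" 0] by simp
    from sp[of "t w @ map Inl w"] this have "mean (?W m) (\<lambda>y. f (sub (t w) y @ w)) \<le> 0" by simp
    then show ?thesis using R_mean[of "\<lambda>z. f (z @ w)" w] True c0
      by (simp add: mult_nonneg_nonpos)
  qed (simp add: R_mean)
  \<comment> \<open>A slice of density d either has \<open>d < \<beta>\<close> or loses c. In both
    cases at most \<open>(1 - c) * d + c * \<beta>\<close> is left, so the excess over \<beta>
    shrinks by the factor \<open>1 - c\<close>.\<close>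
  have dens': "mean (?W N0) (\<lambda>z. dens q (T * N0) (D' z)) - \<beta> \<le> (1 - c) * (dens q (Suc T * N0) D - \<beta>)"
  proof -
    have "mean (?W N0) (\<lambda>z. dens q (T * N0) (D' z))
      = mean (?W N0) (\<lambda>z. mean (?W (T * N0)) (\<lambda>w. of_bool (z @ w \<in> D) - of_bool (R z w)))"
      unfolding dens_def by (intro mean_cong) (auto simp: D'_def dest: R_D)
    also have "\<dots> = mean (?W (T * N0)) (\<lambda>w. mean (?W N0) (\<lambda>z. of_bool (z @ w \<in> D))
        - mean (?W N0) (\<lambda>z. 1 * of_bool (R z w)))"
      by (subst mean_swap) (simp add: mean_diff)
    also have "\<dots> \<le> mean (?W (T * N0)) (\<lambda>w. (1 - c) * mean (?W N0) (\<lambda>z. of_bool (z @ w \<in> D)) + c * \<beta>)"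
    proof (rule mean_mono)
      fix w
      let ?d = "mean (?W N0) (\<lambda>z. of_bool (z @ w \<in> D))"
      have d: "?d = dens q N0 (Dw w)" by (simp add: dens_def Dw_def)
      have "c * ?d \<le> c * 1" using c0 dens_le_1[OF q] unfolding d by (rule mult_left_mono[rotated])
      moreover have "\<not> P w \<Longrightarrow> c * ?d \<le> c * \<beta>"
        using c0 unfolding d P_def by (intro mult_left_mono) auto
      moreover have "0 \<le> c * \<beta>" using c0 \<beta> by simp
      moreover have "mean (?W N0) (\<lambda>z. 1 * of_bool (R z w)) = (if P w then c else 0)"
        unfolding R_mean using fin ne by (simp add: mean_const)
      ultimately show "?d - mean (?W N0) (\<lambda>z. 1 * of_bool (R z w)) \<le> (1 - c) * ?d + c * \<beta>"
        by (cases "P w") (simp_all add: left_diff_distrib)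
    qed
    also have "\<dots> = (1 - c) * dens q (Suc T * N0) D + c * \<beta>"
      using fin ne by (simp add: dens_def mean_words_add' mean_add mean_cmult mean_const)
    finally show ?thesis by (simp add: algebra_simps)
  qed
  have "mean (?W (Suc T * N0)) (\<lambda>w. f w * of_bool (w \<in> D))
    = mean (?W N0) (\<lambda>z. mean (?W (T * N0)) (\<lambda>w. f (z @ w) * of_bool (z @ w \<in> D)))"
    by (simp add: mean_words_add)
  also have "\<dots> = mean (?W N0) (\<lambda>z. mean (?W (T * N0)) (\<lambda>w. f (z @ w) * of_bool (w \<in> D' z)))
    + mean (?W (T * N0)) (\<lambda>w. mean (?W N0) (\<lambda>z. f (z @ w) * of_bool (R z w)))"
    by (subst mean_swap, subst mean_add[symmetric], subst mean_swap, subst mean_add[symmetric],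
        subst mean_swap) (intro mean_cong, auto simp: D'_def dest: R_D)
  also have "\<dots> \<le> mean (?W N0) (\<lambda>z. \<beta> + (1 - c) ^ T * (dens q (T * N0) (D' z) - \<beta>)) + 0"
  proof (intro add_mono mean_mono)
    fix z assume z: "z \<in> ?W N0"
    show "mean (?W (T * N0)) (\<lambda>w. f (z @ w) * of_bool (w \<in> D' z))
      \<le> \<beta> + (1 - c) ^ T * (dens q (T * N0) (D' z) - \<beta>)"
    proof (rule Suc.IH)
      fix s assume "s \<in> subspaces q m (T * N0)"
      from subspaces_surround[OF this z, of "[]" 0]
      have "map Inl z @ s \<in> subspaces q m (Suc T * N0)" by simp
      from sp[OF this] show "mean (?W m) (\<lambda>y. f (z @ sub s y)) \<le> 0" by simp
    qed (use f D'_ins in auto)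
  next
    show "mean (?W (T * N0)) (\<lambda>w. mean (?W N0) (\<lambda>z. f (z @ w) * of_bool (R z w))) \<le> 0"
      by (rule mean_le[OF fin ne]) (rule R_le)
  qed
  also have "\<dots> = \<beta> + (1 - c) ^ T * (mean (?W N0) (\<lambda>z. dens q (T * N0) (D' z)) - \<beta>)"
    using fin ne by (simp add: mean_add mean_diff mean_cmult mean_const)
  also have "\<dots> \<le> \<beta> + (1 - c) ^ T * ((1 - c) * (dens q (Suc T * N0) D - \<beta>))"
    using dens' c1 by (intro add_left_mono mult_left_mono) auto
  finally show ?case by (simp add: mult_ac)
qed

text \<open>Up to density \<beta>, the set D is exhausted by disjoint m-dimensional subspaces, on
  which f contributes at most 0; on the rest \<open>f \<le> 1\<close> is used. The number T of
  blocks makes \<open>(1 - c) ^ T\<close> small.\<close>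

lemma insensitive_bound:
  assumes k: "k > 0" and dhj: "dhj k" and i: "i < k" and \<beta>: "\<beta> > 0"
  shows "\<exists>n. \<forall>f D. (\<forall>w. f w \<le> 1) \<longrightarrow> insensitive k i D \<longrightarrow>
    (\<forall>t\<in>subspaces (Suc k) m n. mean (words {..<Suc k} m) (\<lambda>y. f (sub t y)) \<le> 0) \<longrightarrow>
    mean (words {..<Suc k} n) (\<lambda>w. f w * of_bool (w \<in> D)) \<le> \<beta>"
proof -
  let ?q = "Suc k"
  \<comment> \<open>Since \<open>b \<le> 1\<close>, the hypothesis applies to \<open>UNIV\<close>;
    the subspace obtained there shows \<open>?q ^ m \<le> ?q ^ N0\<close>, hence
    \<open>c \<le> 1\<close>.\<close>
  define b where "b = min (\<beta> / 2) 1"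
  have b: "b > 0" "b \<le> 1" "b \<le> \<beta> / 2" using \<beta> by (auto simp: b_def)
  obtain N0 where N0: "\<And>D. insensitive k i D \<Longrightarrow> b \<le> dens ?q N0 D \<Longrightarrow>
      \<exists>t\<in>subspaces ?q m N0. \<forall>y\<in>words {..<?q} m. sub t y \<in> D"
    using dense_insensitive_contains_subspace[OF k dhj i b(1), of m] by blast
  have "dens ?q N0 UNIV = 1" by (simp add: dens_def mean_const)
  then obtain t where t: "t \<in> subspaces ?q m N0"
    using N0[of UNIV] b(2) by (auto simp: insensitive_def)
  define c where "c = real (?q ^ m) / real (?q ^ N0)"
  have "card (sub t ` words {..<?q} m) \<le> card (words {..<?q} N0)"
    using sub_words[OF subspacesD[OF t], of _ "{..<?q}"] by (intro card_mono) auto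
  then have "?q ^ m \<le> ?q ^ N0"
    using card_image[OF inj_on_sub[OF t, of "{..<?q}"]] by (simp only: card_words finite_lessThan card_lessThan)
  then have c: "0 < c" "c \<le> 1" by (simp_all add: c_def del: of_nat_power power_Suc)
  then have "(\<lambda>T. (1 - c) ^ T) \<longlonglongrightarrow> 0" by (intro LIMSEQ_power_zero) auto
  then obtain T where T: "(1 - c) ^ T < \<beta> / 2"
    using \<beta> c by (auto simp: LIMSEQ_iff dest!: spec[of _ "\<beta> / 2"])
  show ?thesis
  proof (intro exI[of _ "T * N0"] allI impI)
    fix f :: "nat list \<Rightarrow> real" and D
    assume f: "\<forall>w. f w \<le> 1" and D: "insensitive k i D"
      and sp: "\<forall>t\<in>subspaces ?q m (T * N0). mean (words {..<?q} m) (\<lambda>y. f (sub t y)) \<le> 0"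
    have "mean (words {..<?q} (T * N0)) (\<lambda>w. f w * of_bool (w \<in> D))
        \<le> b + (1 - c) ^ T * (dens ?q (T * N0) D - b)"
      unfolding c_def
      by (rule insensitive_blocks_bound) (use N0 c b f D sp in \<open>auto simp: c_def\<close>)
    also have "\<dots> \<le> b + (1 - c) ^ T * 1"
      using b c dens_le_1[of ?q "T * N0" D] by (intro add_left_mono mult_left_mono) auto
    finally show "mean (words {..<?q} (T * N0)) (\<lambda>w. f w * of_bool (w \<in> D)) \<le> \<beta>"
      using T b(3) by simp
  qed
qed

lemma subspaces_id: "map Inr [0..<m] \<in> subspaces k m m"
  by (auto simp: subspaces_def words_def letters_def)

lemma sub_id: "length y = m \<Longrightarrow> sub (map Inr [0..<m]) y = y"
  by (auto simp: sub_def comp_def intro: nth_equalityI)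

text \<open>The sets are treated one at a time: \<open>D j\<close> is exhausted by subspaces of a
  dimension M so large that the induction hypothesis handles the other j sets inside each of them,
  where their preimages are again insensitive.\<close>

lemma insensitive_Inter_bound:
  assumes k: "k > 0" and dhj: "dhj k"
  shows "j \<le> k \<Longrightarrow> \<beta> > 0 \<Longrightarrow> \<exists>n. \<forall>f D. (\<forall>w. f w \<le> 1) \<longrightarrow> (\<forall>i<j. insensitive k i (D i)) \<longrightarrow>
    (\<forall>t\<in>subspaces (Suc k) m n. mean (words {..<Suc k} m) (\<lambda>y. f (sub t y)) \<le> 0) \<longrightarrow>
    mean (words {..<Suc k} n) (\<lambda>w. f w * of_bool (\<forall>i<j. w \<in> D i)) \<le> \<beta>"
proof (induction j arbitrary: \<beta>)
  case 0
  show ?case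
  proof (intro exI[of _ m] allI impI)
    fix f :: "nat list \<Rightarrow> real" and D :: "nat \<Rightarrow> nat list set"
    assume "\<forall>t\<in>subspaces (Suc k) m m. mean (words {..<Suc k} m) (\<lambda>y. f (sub t y)) \<le> 0"
    from bspec[OF this subspaces_id]
    have "mean (words {..<Suc k} m) (\<lambda>y. f (sub (map Inr [0..<m]) y)) \<le> 0" .
    also have "mean (words {..<Suc k} m) (\<lambda>y. f (sub (map Inr [0..<m]) y)) = mean (words {..<Suc k} m) f"
      by (intro mean_cong) (auto dest: length_words simp: sub_id)
    finally show "mean (words {..<Suc k} m) (\<lambda>w. f w * of_bool (\<forall>i<0. w \<in> D i)) \<le> \<beta>"
      using 0 by simp
  qed
next
  case (Suc j)
  let ?W = "words {..<Suc k}"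
  have b2: "\<beta> / 2 > 0" using Suc.prems by simp
  obtain M where M: "\<And>f D. (\<And>w. f w \<le> 1) \<Longrightarrow> (\<And>i. i < j \<Longrightarrow> insensitive k i (D i)) \<Longrightarrow>
      (\<And>t. t \<in> subspaces (Suc k) m M \<Longrightarrow> mean (?W m) (\<lambda>y. f (sub t y)) \<le> 0) \<Longrightarrow>
      mean (?W M) (\<lambda>w. f w * of_bool (\<forall>i<j. w \<in> D i)) \<le> \<beta> / 2"
    using Suc.IH[OF Suc_leD[OF Suc.prems(1)] b2] by blast
  obtain N where N: "\<And>f D. (\<And>w. f w \<le> 1) \<Longrightarrow> insensitive k j D \<Longrightarrow>
      (\<And>t. t \<in> subspaces (Suc k) M N \<Longrightarrow> mean (?W M) (\<lambda>y. f (sub t y)) \<le> 0) \<Longrightarrow>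
      mean (?W N) (\<lambda>w. f w * of_bool (w \<in> D)) \<le> \<beta> / 2"
    using insensitive_bound[OF k dhj Suc_le_lessD[OF Suc.prems(1)] b2, of M] by blast
  show ?case
  proof (intro exI[of _ N] allI impI)
    fix f :: "nat list \<Rightarrow> real" and D :: "nat \<Rightarrow> nat list set"
    assume f: "\<forall>w. f w \<le> 1" and D: "\<forall>i<Suc j. insensitive k i (D i)"
      and sp: "\<forall>t\<in>subspaces (Suc k) m N. mean (?W m) (\<lambda>y. f (sub t y)) \<le> 0"
    \<comment> \<open>Subtracting \<open>\<beta> / 2\<close> turns the bound given by M into a mean
      of at most 0 on M-dimensional subspaces, which is the form that N requires.\<close>
    let ?F = "\<lambda>w. f w * of_bool (\<forall>i<j. w \<in> D i) - \<beta> / 2"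
    have "mean (?W N) (\<lambda>w. ?F w * of_bool (w \<in> D j)) \<le> \<beta> / 2"
    proof (rule N)
      show "?F w \<le> 1" for w using f[rule_format, of w] b2 by (cases "\<forall>i<j. w \<in> D i") auto
      show "insensitive k j (D j)" using D by simp
      fix t assume t: "t \<in> subspaces (Suc k) M N"
      have "mean (?W M) (\<lambda>y. f (sub t y) * of_bool (\<forall>i<j. y \<in> {y. length y = M \<and> sub t y \<in> D i})) \<le> \<beta> / 2"
      proof (rule M)
        show "insensitive k i {y. length y = M \<and> sub t y \<in> D i}" if "i < j" for i
          using D that by (intro insensitive_preimage[OF _ subspacesD[OF t]]) auto
        fix s assume "s \<in> subspaces (Suc k) m M"
        from subspaces_compose[OF t this] obtain t' where
          "t' \<in> subspaces (Suc k) m N" "\<And>y. sub t' y = sub t (sub s y)" by auto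
        with sp show "mean (?W m) (\<lambda>y. f (sub t (sub s y))) \<le> 0" by auto
      qed (use f in auto)
      also have "mean (?W M) (\<lambda>y. f (sub t y) * of_bool (\<forall>i<j. y \<in> {y. length y = M \<and> sub t y \<in> D i}))
        = mean (?W M) (\<lambda>y. f (sub t y) * of_bool (\<forall>i<j. sub t y \<in> D i))"
        by (intro mean_cong) (auto dest!: length_words)
      finally show "mean (?W M) (\<lambda>y. ?F (sub t y)) \<le> 0"
        by (simp add: mean_diff mean_const)
    qed
    moreover have "mean (?W N) (\<lambda>w. f w * of_bool (\<forall>i<Suc j. w \<in> D i))
      = mean (?W N) (\<lambda>w. ?F w * of_bool (w \<in> D j)) + \<beta> / 2 * dens (Suc k) N (D j)"
      unfolding dens_def mean_cmult[symmetric] mean_add[symmetric]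
      by (intro mean_cong) (auto simp: less_Suc_eq)
    moreover have "\<beta> / 2 * dens (Suc k) N (D j) \<le> \<beta> / 2 * 1"
      using b2 dens_le_1[of "Suc k"] by (intro mult_left_mono) auto
    ultimately show "mean (?W N) (\<lambda>w. f w * of_bool (\<forall>i<Suc j. w \<in> D i)) \<le> \<beta>" by linarith
  qed
qed

section \<open>The density Hales--Jewett theorem\<close>

text \<open>This cuts the complement of an intersection of insensitive sets by the first condition
  that fails. Complements of insensitive sets are insensitive, so each piece is again such an
  intersection.\<close>

lemma sum_first_failure:
  "(\<Sum>i<(k::nat). of_bool ((\<forall>i'<i. P i') \<and> \<not> P i)) = (of_bool (\<not> (\<forall>i<k. P i)) :: real)"
  by (induction k) (auto simp: less_Suc_eq)

text \<open>Where all \<open>C i\<close> hold, A is absent, as otherwise a line over [k + 1] would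
  arise. Elsewhere \<open>f\<close>, the indicator of A minus d, has mean at most 0 on m-dimensional
  subspaces, so each of the k pieces of first failure contributes at most \<beta>.\<close>

lemma line_free_bound:
  fixes k :: nat and A :: "nat list set"
  defines "W \<equiv> words {..<Suc k}"
  assumes bound: "\<And>f D. (\<And>w. f w \<le> (1::real)) \<Longrightarrow> (\<And>i. i < k \<Longrightarrow> insensitive k i (D i)) \<Longrightarrow>
      (\<And>t. t \<in> subspaces (Suc k) m M \<Longrightarrow> mean (W m) (\<lambda>y. f (sub t y)) \<le> 0) \<Longrightarrow>
      mean (W M) (\<lambda>w. f w * of_bool (\<forall>i<k. w \<in> D i)) \<le> \<beta>"
    and x: "x \<in> W a" and x': "x' \<in> W b" and s: "s \<in> W a'" and s': "s' \<in> W b'"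
    and n: "n = a + (a' + Suc M + b') + b"
    and nl: "\<not> has_line (Suc k) n A"
    and d: "d \<ge> 0" "\<And>t. t \<in> subspaces (Suc k) m n \<Longrightarrow> mean (W m) (\<lambda>y. of_bool (sub t y \<in> A)) \<le> d"
  shows "mean (W M) (\<lambda>y. of_bool (x @ (s @ k # y @ s') @ x' \<in> A))
    \<le> d * (1 - mean (W M) (\<lambda>y. of_bool (\<forall>i<k. x @ rep k i (s @ k # y @ s') @ x' \<in> A))) + real k * \<beta>"
proof -
  let ?w = "\<lambda>y. s @ k # y @ s'"
  define C where "C i = {y. x @ rep k i (?w y) @ x' \<in> A}" for i
  define E where "E i y \<longleftrightarrow> (\<forall>i'<i. y \<in> C i') \<and> y \<notin> C i" for i y
  define v where "v = map Inl (x @ s @ [k]) @ map Inr [0..<M] @ map Inl (s' @ x')"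
  define f where "f y = of_bool (sub v y \<in> A) - d" for y
  have v: "v \<in> subspaces (Suc k) M n"
  proof -
    have "x @ s @ [k] \<in> words {..<Suc k} (a + (a' + 1))" "s' @ x' \<in> words {..<Suc k} (b' + b)"
      using x x' s s' unfolding W_def by (auto simp: words_def)
    from subspaces_surround[OF subspaces_id this] show ?thesis unfolding v_def n
      by (simp add: add_ac)
  qed
  have sub_v: "sub v y = x @ ?w y @ x'" if "y \<in> W M" for y
    using that unfolding v_def W_def sub_append sub_Inl by (auto dest!: length_words simp: sub_id)
  have C_ins: "insensitive k i (C i)" for i
    by (simp add: insensitive_def C_def)
  have E_bound: "mean (W M) (\<lambda>y. f y * of_bool (E i y)) \<le> \<beta>" if i: "i < k" for i
  proof -
    define D where "D i' = (if i' < i then C i' else if i' = i then - C i else UNIV)" for i'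
    have "E i y \<longleftrightarrow> (\<forall>i'<k. y \<in> D i')" for y
      using i unfolding E_def D_def by (auto split: if_splits)
    then have "mean (W M) (\<lambda>y. f y * of_bool (E i y)) = mean (W M) (\<lambda>w. f w * of_bool (\<forall>i'<k. w \<in> D i'))"
      by simp
    also have "\<dots> \<le> \<beta>"
    proof (rule bound)
      show "f w \<le> 1" for w using d(1) by (simp add: f_def)
      show "insensitive k i' (D i')" for i'
        using C_ins by (auto simp: D_def insensitive_def)
      fix t assume "t \<in> subspaces (Suc k) m M"
      from subspaces_compose[OF v this] obtain t' where
        t': "t' \<in> subspaces (Suc k) m n" "\<And>y. sub t' y = sub v (sub t y)" by auto
      have "mean (W m) (\<lambda>y. f (sub t y)) = mean (W m) (\<lambda>y. of_bool (sub t' y \<in> A)) - d"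
        unfolding f_def mean_diff t'(2) W_def by simp
      also have "\<dots> \<le> 0" using d(2)[OF t'(1)] by simp
      finally show "mean (W m) (\<lambda>y. f (sub t y)) \<le> 0" .
    qed
    finally show ?thesis .
  qed
  have no_line: "sub v y \<notin> A" if y: "y \<in> W M" and yC: "\<forall>i<k. y \<in> C i" for y
  proof
    assume yA: "sub v y \<in> A"
    define u where "u = ?w y"
    have w: "u \<in> W (a' + Suc M + b')"
      using s s' y unfolding u_def W_def by (auto simp: words_def)
    have rr: "rep (Suc k) i (rep k (Suc k) u) = rep k i u" for i
      using w unfolding W_def words_def rep_def by (auto simp: subset_iff)
    have fix': "rep (Suc k) i z = z" if "z \<in> W c" for z c i
      using that unfolding W_def words_def by (intro rep_id) auto
    \<comment> \<open>The letters k of u become the variable \<open>Suc k\<close>, while those of x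
      and x' stay constant. The points with \<open>i < k\<close> lie in A by \<open>yC\<close>, and
      the point \<open>i = k\<close> is the original word. The letter k in front of y ensures that
      the variable occurs.\<close>
    let ?l = "x @ rep k (Suc k) u @ x'"
    have "?l \<in> words {..Suc k} n"
      using x x' w unfolding n W_def words_def by (auto simp: rep_def subset_iff le_Suc_eq less_Suc_eq_le)
    moreover have "Suc k \<in> set ?l" by (simp add: u_def)
    moreover have "rep (Suc k) i ?l \<in> A" if "i < Suc k" for i
    proof -
      have "rep k k u = u" by (auto simp: rep_def intro: map_idI)
      then have "x @ rep k i u @ x' \<in> A"
        using that yA yC sub_v[OF y] by (cases "i = k") (auto simp: C_def u_def)
      then show ?thesis by (simp add: rr fix'[OF x] fix'[OF x'])
    qed
    ultimately show False using nl unfolding has_line_def by blast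
  qed
  have "mean (W M) (\<lambda>y. of_bool (x @ ?w y @ x' \<in> A))
    \<le> mean (W M) (\<lambda>y. d * (1 - of_bool (\<forall>i<k. y \<in> C i)) + (\<Sum>i<k. f y * of_bool (E i y)))"
  proof (rule mean_mono)
    fix y assume y: "y \<in> W M"
    have eq: "(\<Sum>i<k. f y * of_bool (E i y)) = f y * of_bool (\<not> (\<forall>i<k. y \<in> C i))"
      unfolding sum_distrib_left[symmetric] E_def sum_first_failure ..
    show "of_bool (x @ ?w y @ x' \<in> A)
      \<le> d * (1 - of_bool (\<forall>i<k. y \<in> C i)) + (\<Sum>i<k. f y * of_bool (E i y))"
      unfolding eq using no_line[OF y] sub_v[OF y] by (cases "\<forall>i<k. y \<in> C i") (auto simp: f_def)
  qed
  also have "\<dots> = d * (1 - mean (W M) (\<lambda>y. of_bool (\<forall>i<k. y \<in> C i)))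
      + (\<Sum>i<k. mean (W M) (\<lambda>y. f y * of_bool (E i y)))"
    unfolding mean_add mean_sum mean_cmult mean_diff W_def by simp
  also have "\<dots> \<le> d * (1 - mean (W M) (\<lambda>y. of_bool (\<forall>i<k. y \<in> C i))) + (\<Sum>i<k. \<beta>)"
    using E_bound by (intro add_left_mono sum_mono) auto
  finally show ?thesis by (simp add: C_def)
qed

section \<open>The density increment and its iteration\<close>

lemma block_regularity_pair:
  fixes S :: "'b set"
  assumes "finite S" "S \<noteq> {}" "\<epsilon> > 0"
  shows "\<exists>n. \<forall>f. (\<forall>w. 0 \<le> f w \<and> f w \<le> 1) \<longrightarrow> (\<exists>a b. a + M + b = n \<and>
    (\<forall>z\<in>words S M. mean (words S n) f - \<epsilon>
      \<le> mean (words S a \<times> words S b) (\<lambda>p. f (fst p @ z @ snd p))))"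
  using block_regularity[OF assms, of M] by (simp add: mean_Times)

text \<open>Fix a position of the two nested blocks given by \<open>block_regularity\<close>. The words \<open>y\<close> of the inner
  block for which the line obtained from \<open>y\<close> by varying the letter \<open>k\<close> over \<open>[k]\<close> lies in \<open>A\<close> form an
  intersection of insensitive sets. It has density at least \<open>\<theta> / 2\<close> on average and, in the absence of
  lines over \<open>[k + 1]\<close>, is disjoint from \<open>A\<close>; hence \<open>A\<close> is denser on the complement. For the average,
  the pattern \<open>l\<close> of a line in \<open>[k]\<^sup>n\<close> has to be fixed by pigeonhole before the inner block is chosen,
  and the template letter \<open>Inr j0\<close>, where \<open>l ! j0 = k\<close>, then plays the role of the letter \<open>k\<close> of \<open>y\<close>.\<close>

lemma density_increment:
  assumes k: "k > 0" and dhj: "dhj k" and \<delta>0: "0 < \<delta>0" "\<delta>0 \<le> 1"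
  shows "\<exists>\<gamma>>0. \<forall>m. \<forall>\<delta>\<ge>\<delta>0. \<exists>n. \<forall>A. \<delta> \<le> dens (Suc k) n A \<longrightarrow> has_line (Suc k) n A \<or>
    (\<exists>t\<in>subspaces (Suc k) m n. \<delta> + \<gamma> \<le> mean (words {..<Suc k} m) (\<lambda>y. of_bool (sub t y \<in> A)))"
proof -
  let ?W = "words {..<Suc k}"
  have d4: "\<delta>0 / 4 > 0" using \<delta>0 by simp
  obtain n0 where n0: "\<And>A. \<delta>0 / 4 \<le> dens k n0 A \<Longrightarrow> has_line k n0 A"
    using dhj d4 unfolding dhj_def by meson
  define \<theta> where "\<theta> = (\<delta>0 / 4) / real ((k + 1) ^ n0)"
  have \<theta>: "\<theta> > 0" "\<theta> \<le> 1"
  proof -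
    show "\<theta> > 0" using \<delta>0 by (simp add: \<theta>_def)
    have "(1::real) \<le> real ((k + 1) ^ n0)" by simp
    then have "\<theta> \<le> (\<delta>0 / 4) / 1" unfolding \<theta>_def using \<delta>0 by (intro divide_left_mono) auto
    then show "\<theta> \<le> 1" using \<delta>0 by simp
  qed
  \<comment> \<open>The final comparison gives
    \<open>(\<delta> + \<gamma>) * (\<theta> / 2) \<le> 3 * \<gamma>\<close>, whereas
    \<open>\<delta>0 * (\<theta> / 2)\<close> equals \<open>4 * \<gamma>\<close>.\<close>
  define \<gamma> where "\<gamma> = \<delta>0 * \<theta> / 8"
  have \<gamma>: "\<gamma> > 0" using \<delta>0 \<theta> by (simp add: \<gamma>_def)
  have \<gamma>2: "\<gamma> \<le> \<delta>0 / 2" using \<delta>0 \<theta> mult_left_le[of \<theta> \<delta>0] by (simp add: \<gamma>_def)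
  have \<gamma>k: "\<gamma> / real k > 0" using \<gamma> k by simp
  show ?thesis
  proof (intro exI[of _ \<gamma>] conjI allI impI \<gamma>)
    fix m :: nat and \<delta> :: real assume \<delta>: "\<delta>0 \<le> \<delta>"
    obtain M where M: "\<And>f D. (\<And>w. f w \<le> (1::real)) \<Longrightarrow> (\<And>i. i < k \<Longrightarrow> insensitive k i (D i)) \<Longrightarrow>
      (\<And>t. t \<in> subspaces (Suc k) m M \<Longrightarrow> mean (?W m) (\<lambda>y. f (sub t y)) \<le> 0) \<Longrightarrow>
      mean (?W M) (\<lambda>w. f w * of_bool (\<forall>i<k. w \<in> D i)) \<le> \<gamma> / real k"
      using insensitive_Inter_bound[OF k dhj order_refl \<gamma>k, of m] by blast
    let ?\<Omega> = "letters k n0"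
    have \<Omega>: "?\<Omega> \<noteq> {}" using k by (auto simp: letters_def)
    have th2: "\<theta> / 2 > 0" using \<theta> by simp
    \<comment> \<open>Words over \<open>?\<Omega>\<close> are templates that map words of length n0
      to words of length S. The inner block has length \<open>Suc M\<close> to accommodate the fixed
      letter k in front of y.\<close>
    obtain S where S: "\<forall>f. (\<forall>w. 0 \<le> f w \<and> f w \<le> 1) \<longrightarrow> (\<exists>a b. a + Suc M + b = S \<and>
      (\<forall>z\<in>words ?\<Omega> (Suc M). mean (words ?\<Omega> S) f - \<theta> / 2
        \<le> mean (words ?\<Omega> a \<times> words ?\<Omega> b) (\<lambda>p. f (fst p @ z @ snd p))))"
      using block_regularity_pair[OF finite_letters \<Omega> th2, of "Suc M"] by blast
    have ne: "{..<Suc k} \<noteq> {}" by auto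
    obtain n where n: "\<forall>f. (\<forall>w. 0 \<le> f w \<and> f w \<le> 1) \<longrightarrow> (\<exists>a b. a + S + b = n \<and>
      (\<forall>z\<in>?W S. mean (?W n) f - \<gamma> \<le> mean (?W a \<times> ?W b) (\<lambda>p. f (fst p @ z @ snd p))))"
      using block_regularity_pair[OF finite_lessThan ne \<gamma>, of S] by blast
    show "\<exists>n. \<forall>A. \<delta> \<le> dens (Suc k) n A \<longrightarrow> has_line (Suc k) n A \<or>
      (\<exists>t\<in>subspaces (Suc k) m n. \<delta> + \<gamma> \<le> mean (?W m) (\<lambda>y. of_bool (sub t y \<in> A)))"
    proof (rule exI[of _ n], intro allI impI, rule ccontr)
      fix A assume A: "\<delta> \<le> dens (Suc k) n A" and "\<not> (has_line (Suc k) n A \<or>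
        (\<exists>t\<in>subspaces (Suc k) m n. \<delta> + \<gamma> \<le> mean (?W m) (\<lambda>y. of_bool (sub t y \<in> A))))"
      then have nl: "\<not> has_line (Suc k) n A" and
        ns: "\<And>t. t \<in> subspaces (Suc k) m n \<Longrightarrow> mean (?W m) (\<lambda>y. of_bool (sub t y \<in> A)) \<le> \<delta> + \<gamma>"
        by (auto simp: not_le less_imp_le)
      obtain a b where ab: "a + S + b = n" and reg: "\<And>z. z \<in> ?W S \<Longrightarrow>
          \<delta> - \<gamma> \<le> mean (?W a \<times> ?W b) (\<lambda>p. of_bool (fst p @ z @ snd p \<in> A))"
        using spec[OF n, of "\<lambda>w. of_bool (w \<in> A)"] A unfolding dens_def by fastforce
      let ?X = "?W a \<times> ?W b"
      have X: "finite ?X" "?X \<noteq> {}" by auto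
      define g where "g l U = mean ?X (\<lambda>p. of_bool (\<forall>i<k. fst p @ sub U (rep k i l) @ snd p \<in> A))" for l U
      \<comment> \<open>Each point \<open>sub U x\<close> has density at least
        \<open>\<delta> - \<gamma>\<close> over the contexts p, so on average p sees a dense set of
        words x over [k], where \<open>dens_le_sum_lines\<close> provides lines.\<close>
      have step1: "\<delta>0 / 4 \<le> (\<Sum>l | l \<in> words {..k} n0 \<and> k \<in> set l. g l U)" if U: "U \<in> words ?\<Omega> S" for U
      proof -
        have "\<delta> - \<gamma> \<le> mean (words {..<k} n0) (\<lambda>x. mean ?X (\<lambda>p. of_bool (fst p @ sub U x @ snd p \<in> A)))"
        proof (rule mean_ge)
          fix x assume "x \<in> words {..<k} n0"
          then have "x \<in> ?W n0" by (auto simp: words_def)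
          from reg[OF sub_words[OF U this]]
          show "\<delta> - \<gamma> \<le> mean ?X (\<lambda>p. of_bool (fst p @ sub U x @ snd p \<in> A))" by auto
        qed (use k in auto)
        also have "\<dots> = mean ?X (\<lambda>p. dens k n0 {x. fst p @ sub U x @ snd p \<in> A})"
          unfolding dens_def by (subst mean_swap) simp
        also have "\<dots> \<le> mean ?X (\<lambda>p. \<delta>0 / 4 + (\<Sum>l | l \<in> words {..k} n0 \<and> k \<in> set l.
            of_bool (\<forall>i<k. rep k i l \<in> {x. fst p @ sub U x @ snd p \<in> A})))"
          by (rule mean_mono) (rule dens_le_sum_lines[OF k n0 d4])
        also have "\<dots> = \<delta>0 / 4 + (\<Sum>l | l \<in> words {..k} n0 \<and> k \<in> set l. g l U)"
          unfolding mean_add mean_sum mean_const[OF X] g_def by simp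
        finally show ?thesis using \<gamma>2 \<delta> by simp
      qed
      have "\<delta>0 / 4 \<le> mean (words ?\<Omega> S) (\<lambda>U. \<Sum>l | l \<in> words {..k} n0 \<and> k \<in> set l. g l U)"
        using \<Omega> step1 by (intro mean_ge) auto
      from ex_line_of_sum[OF this[unfolded mean_sum] d4] obtain l where
        l: "l \<in> words {..k} n0" "k \<in> set l" "\<theta> \<le> mean (words ?\<Omega> S) (g l)"
        unfolding \<theta>_def by blast
      have lW: "l \<in> ?W n0" using l(1) by (simp add: lessThan_Suc_atMost)
      have g01: "0 \<le> g l w \<and> g l w \<le> 1" for w
        unfolding g_def using X by (intro conjI mean_nonneg mean_le) auto
      obtain a' b' where ab': "a' + Suc M + b' = S" and reg': "\<And>z. z \<in> words ?\<Omega> (Suc M) \<Longrightarrow>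
        \<theta> / 2 \<le> mean (words ?\<Omega> a' \<times> words ?\<Omega> b') (\<lambda>p. g l (fst p @ z @ snd p))"
        using spec[OF S, of "g l"] g01 l(3) by fastforce
      let ?Y = "words ?\<Omega> a' \<times> words ?\<Omega> b'"
      have Y: "finite ?Y" "?Y \<noteq> {}" using \<Omega> by auto
      obtain j0 where j0: "j0 < n0" "l ! j0 = k"
        using l(1,2) by (auto simp: in_set_conv_nth words_def)
      define w where "w u y = sub (fst u) l @ k # y @ sub (snd u) l" for u y
      define h where "h u p = mean (?W M) (\<lambda>y. of_bool (fst p @ w u y @ snd p \<in> A))" for u p
      define c where "c u p = mean (?W M) (\<lambda>y. of_bool (\<forall>i<k. fst p @ rep k i (w u y) @ snd p \<in> A))" for u p
      have key: "h u p \<le> (\<delta> + \<gamma>) * (1 - c u p) + \<gamma>" if "u \<in> ?Y" "p \<in> ?X" for u p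
      proof -
        have "sub (fst u) l \<in> ?W a'" "sub (snd u) l \<in> ?W b'" "fst p \<in> ?W a" "snd p \<in> ?W b"
          using that sub_words[OF _ lW] by auto
        from line_free_bound[OF M this(3,4,1,2) _ nl _ ns] show ?thesis
          unfolding h_def c_def w_def using k ab ab' \<delta> \<delta>0 \<gamma> by auto
      qed
      have wS: "w u y \<in> ?W S" if "u \<in> ?Y" "y \<in> ?W M" for u y
      proof -
        have "sub (fst u) l \<in> ?W a'" "sub (snd u) l \<in> ?W b'"
          using that sub_words[OF _ lW] by auto
        then show ?thesis using that unfolding w_def ab'[symmetric] words_def by auto
      qed
      have h_mean: "\<delta> - \<gamma> \<le> mean ?Y (\<lambda>u. mean ?X (h u))"
      proof (rule mean_ge[OF Y])
        fix u assume u: "u \<in> ?Y"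
        have "\<delta> - \<gamma> \<le> mean (?W M) (\<lambda>y. mean ?X (\<lambda>p. of_bool (fst p @ w u y @ snd p \<in> A)))"
          by (rule mean_ge) (use reg wS[OF u] in auto)
        then show "\<delta> - \<gamma> \<le> mean ?X (h u)" unfolding h_def by (subst mean_swap)
      qed
      have c_mean: "\<theta> / 2 \<le> mean ?Y (\<lambda>u. mean ?X (c u))"
      proof -
        let ?z = "\<lambda>y. Inr j0 # map (\<lambda>c. if c < k then Inl c else Inr j0) y"
        have "\<theta> / 2 \<le> mean (?W M) (\<lambda>y. mean ?Y (\<lambda>u. g l (fst u @ ?z y @ snd u)))"
        proof (rule mean_ge)
          fix y assume "y \<in> ?W M"
          then have "?z y \<in> words ?\<Omega> (Suc M)"
            using j0 by (auto simp: words_def letters_def)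
          from reg'[OF this] show "\<theta> / 2 \<le> mean ?Y (\<lambda>u. g l (fst u @ ?z y @ snd u))" .
        qed auto
        also have "\<dots> = mean (?W M) (\<lambda>y. mean ?Y (\<lambda>u. mean ?X
          (\<lambda>p. of_bool (\<forall>i<k. fst p @ rep k i (w u y) @ snd p \<in> A))))"
        proof (intro mean_cong)
          fix y u assume y: "y \<in> ?W M" and u: "u \<in> ?Y"
          have "sub (fst u @ ?z y @ snd u) (rep k i l) = rep k i (w u y)" for i
          proof -
            have "rep k i l ! j0 = i" using j0 l(1) by (simp add: rep_def length_words)
            then have "sub (?z y) (rep k i l) = rep k i (k # y)"
              using y by (auto simp: sub_def rep_def words_def)
            moreover have "sub (fst u) (rep k i l) = rep k i (sub (fst u) l)"
              "sub (snd u) (rep k i l) = rep k i (sub (snd u) l)"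
              using u rep_sub[OF _ length_words[OF l(1)]] by auto
            ultimately show ?thesis unfolding w_def sub_append by simp
          qed
          then show "g l (fst u @ ?z y @ snd u) = mean ?X
            (\<lambda>p. of_bool (\<forall>i<k. fst p @ rep k i (w u y) @ snd p \<in> A))"
            unfolding g_def by simp
        qed
        also have "\<dots> = mean ?Y (\<lambda>u. mean ?X (c u))"
          unfolding c_def by (subst mean_swap, rule mean_cong, rule mean_swap)
        finally show ?thesis .
      qed
      have "\<delta> - \<gamma> \<le> mean ?Y (\<lambda>u. mean ?X (\<lambda>p. (\<delta> + \<gamma>) * (1 - c u p) + \<gamma>))"
        using h_mean by (rule order_trans) (intro mean_mono key)
      also have "\<dots> = (\<delta> + \<gamma>) * (1 - mean ?Y (\<lambda>u. mean ?X (c u))) + \<gamma>"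
        unfolding mean_add mean_cmult mean_diff mean_const[OF X] mean_const[OF Y] ..
      also have "\<dots> \<le> (\<delta> + \<gamma>) * (1 - \<theta> / 2) + \<gamma>"
        using c_mean \<delta> \<delta>0 \<gamma> by (intro add_right_mono mult_left_mono) auto
      finally have "(\<delta> + \<gamma>) * (\<theta> / 2) \<le> 3 * \<gamma>" by (simp add: algebra_simps)
      moreover have "\<delta>0 * (\<theta> / 2) \<le> (\<delta> + \<gamma>) * (\<theta> / 2)"
        using \<delta> \<gamma> \<theta> by (intro mult_right_mono) auto
      moreover have "\<delta>0 * (\<theta> / 2) = 4 * \<gamma>" by (simp add: \<gamma>_def)
      ultimately show False using \<gamma> by linarith
    qed
  qed
qed

lemma has_line_preimage:
  assumes t: "t \<in> subspaces k m n" and "has_line k m {y. sub t y \<in> A}"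
  shows "has_line k n A"
proof -
  obtain l where l: "l \<in> words {..k} m" "k \<in> set l" "\<And>i. i < k \<Longrightarrow> sub t (rep k i l) \<in> A"
    using assms(2) by (auto simp: has_line_def)
  have tw: "t \<in> words (letters k m) n" by (rule subspacesD[OF t])
  have "sub t l \<in> words {..k} n" by (rule sub_words[OF tw l(1)]) auto
  moreover obtain j where "j < m" "l ! j = k"
    using l(1,2) by (auto simp: in_set_conv_nth words_def)
  then have "k \<in> set (sub t l)"
    using t by (force simp: subspaces_def sub_def)
  moreover have "rep k i (sub t l) \<in> A" if "i < k" for i
    using l(3)[OF that] rep_sub[OF tw length_words[OF l(1)]] by simp
  ultimately show ?thesis unfolding has_line_def by blast
qed

text \<open>The increment \<gamma> depends only on the lower bound d of the density, so boundedly
  many increments would push the density beyond 1; j counts those still available.\<close>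

lemma density_hales_jewett: "k > 0 \<Longrightarrow> dhj k"
proof (induction k rule: nat_induct_non_zero)
  case 1
  show ?case unfolding dhj_def
  proof (intro allI impI exI[of _ 1])
    fix \<delta> :: real and A assume "\<delta> > 0" "\<delta> \<le> dens 1 1 A"
    moreover have "words {..<1::nat} 1 = {[0]}" by (auto simp: words_def length_Suc_conv)
    ultimately have "[0] \<in> A" by (cases "[0] \<in> A") (auto simp: dens_def)
    then show "has_line 1 1 A"
      unfolding has_line_def by (intro bexI[of _ "[1]"]) (auto simp: words_def rep_def)
  qed
next
  case (Suc k)
  show ?case unfolding dhj_def
  proof (intro allI impI)
    fix \<delta>0 :: real assume "\<delta>0 > 0"
    define d where "d = min \<delta>0 1"
    have d: "0 < d" "d \<le> 1" "d \<le> \<delta>0" using \<open>\<delta>0 > 0\<close> by (auto simp: d_def)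
    obtain \<gamma> where \<gamma>: "\<gamma> > 0" and inc: "\<And>m \<delta>. d \<le> \<delta> \<Longrightarrow> \<exists>n. \<forall>A. \<delta> \<le> dens (Suc k) n A \<longrightarrow>
      has_line (Suc k) n A \<or>
      (\<exists>t\<in>subspaces (Suc k) m n. \<delta> + \<gamma> \<le> mean (words {..<Suc k} m) (\<lambda>y. of_bool (sub t y \<in> A)))"
      using density_increment[OF Suc.hyps Suc.IH d(1,2)] by auto
    have "d \<le> \<delta> \<Longrightarrow> 1 < \<delta> + real j * \<gamma> \<Longrightarrow> \<exists>n. \<forall>A. \<delta> \<le> dens (Suc k) n A \<longrightarrow> has_line (Suc k) n A" for \<delta> j
    proof (induction j arbitrary: \<delta>)
      case 0
      have "\<not> \<delta> \<le> dens (Suc k) 0 A" for A using dens_le_1[of "Suc k" 0 A] 0 by simp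
      then show ?case by blast
    next
      case (Suc j)
      obtain m where m: "\<And>A. \<delta> + \<gamma> \<le> dens (Suc k) m A \<Longrightarrow> has_line (Suc k) m A"
        using Suc.IH[of "\<delta> + \<gamma>"] Suc.prems \<gamma> by (auto simp: algebra_simps)
      obtain n where n: "\<And>A. \<delta> \<le> dens (Suc k) n A \<Longrightarrow> has_line (Suc k) n A \<or>
        (\<exists>t\<in>subspaces (Suc k) m n. \<delta> + \<gamma> \<le> mean (words {..<Suc k} m) (\<lambda>y. of_bool (sub t y \<in> A)))"
        using inc[OF Suc.prems(1), of m] by blast
      have "has_line (Suc k) n A" if "\<delta> \<le> dens (Suc k) n A" for A
        using n[OF that]
      proof
        assume "\<exists>t\<in>subspaces (Suc k) m n. \<delta> + \<gamma> \<le> mean (words {..<Suc k} m) (\<lambda>y. of_bool (sub t y \<in> A))"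
        then obtain t where t: "t \<in> subspaces (Suc k) m n"
          "\<delta> + \<gamma> \<le> dens (Suc k) m {y. sub t y \<in> A}" by (auto simp: dens_def)
        from has_line_preimage[OF t(1) m[OF t(2)]] show ?thesis .
      qed
      then show ?case by blast
    qed
    moreover obtain j where "1 < real j * \<gamma>" using reals_Archimedean3[OF \<gamma>] by blast
    then have "1 < d + real j * \<gamma>" using d by simp
    ultimately obtain n where "\<And>A. d \<le> dens (Suc k) n A \<Longrightarrow> has_line (Suc k) n A" by blast
    then show "\<exists>n. \<forall>A. \<delta>0 \<le> dens (Suc k) n A \<longrightarrow> has_line (Suc k) n A"
      using d(3) by (meson order_trans)
  qed
qed

section \<open>Product trees\<close>

abbreviation lev :: "nat \<times> nat \<Rightarrow> 'a Gam set" where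
  "lev s \<equiv> {\<gamma>. Level \<gamma> = s}"

lemma Level_mult [simp]: "Level (Gam_mult x y) = Level x + Level y"
  by (simp add: Level_def Gam_mult_def)

lemma Gam_mult_assoc: "Gam_mult (Gam_mult x y) z = Gam_mult x (Gam_mult y z)"
  by (simp add: Gam_mult_def)

lemma lev_eq_words: "lev s = words UNIV (fst s) \<times> words UNIV (snd s)"
  by (auto simp: Level_def words_def)

lemma finite_lev [simp]: "finite (lev s :: 'a::finite Gam set)"
  by (simp add: lev_eq_words)

lemma lev_nonempty: "lev s \<noteq> ({} :: 'a Gam set)"
  unfolding lev_eq_words by auto

lemma ex_Level [simp]: "\<exists>a b. Level (a, b) = s"
  using lev_nonempty[of s] by auto

lemma mean_lev_const [simp]: "mean (lev s :: 'a::finite Gam set) (\<lambda>_. c) = c"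
  by (rule mean_const[OF finite_lev lev_nonempty])

lemma mean_lev_add:
  "mean (lev (s + t)) f = mean (lev s) (\<lambda>x. mean (lev t) (\<lambda>y. f (Gam_mult x y)))"
proof -
  let ?W = "words UNIV"
  have "mean (lev (s + t)) f = mean (?W (fst s)) (\<lambda>x. mean (?W (fst t)) (\<lambda>x'.
      mean (?W (snd s)) (\<lambda>y. mean (?W (snd t)) (\<lambda>y'. f (x @ x', y @ y')))))"
    by (simp add: lev_eq_words mean_Times mean_words_add)
  also have "\<dots> = mean (?W (fst s)) (\<lambda>x. mean (?W (snd s)) (\<lambda>y.
      mean (?W (fst t)) (\<lambda>x'. mean (?W (snd t)) (\<lambda>y'. f (x @ x', y @ y')))))"
    by (intro mean_cong mean_swap)
  finally show ?thesis by (simp add: lev_eq_words mean_Times Gam_mult_def)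
qed

lemma mean_lev_10: "mean (lev (1, 0) :: 'a::finite Gam set) f = (\<Sum>l\<in>UNIV. f ([l], [])) / real (card (UNIV :: 'a set))"
proof -
  have "bij_betw (\<lambda>l. ([l], [])) (UNIV :: 'a set) (lev (1, 0))"
    by (rule bij_betwI') (auto simp: Level_def length_Suc_conv)
  then show ?thesis by (subst mean_bij) (auto simp: mean_def)
qed

lemma mean_lev_01: "mean (lev (0, 1) :: 'a::finite Gam set) f = (\<Sum>l\<in>UNIV. f ([], [l])) / real (card (UNIV :: 'a set))"
proof -
  have "bij_betw (\<lambda>l. ([], [l])) (UNIV :: 'a set) (lev (0, 1))"
    by (rule bij_betwI') (auto simp: Level_def length_Suc_conv)
  then show ?thesis by (subst mean_bij) (auto simp: mean_def)
qed

text \<open>The function \<open>g\<close> of the overview is \<open>ldens A (K, K)\<close>.\<close>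

definition ldens :: "'a Gam set \<Rightarrow> nat \<times> nat \<Rightarrow> 'a Gam \<Rightarrow> real" where
  "ldens A s \<gamma> = mean (lev s) (\<lambda>\<delta>. of_bool (Gam_mult \<gamma> \<delta> \<in> A))"

lemma ldens_nonneg: "0 \<le> ldens A s \<gamma>"
  unfolding ldens_def by (rule mean_nonneg) simp

lemma ldens_le_1: "ldens (A :: 'a::finite Gam set) s \<gamma> \<le> 1"
  unfolding ldens_def by (rule mean_le) auto

lemma ldens_add: "ldens A (s + t) \<gamma> = mean (lev s) (\<lambda>\<delta>. ldens A t (Gam_mult \<gamma> \<delta>))"
  unfolding ldens_def mean_lev_add by (simp add: Gam_mult_assoc)

text \<open>Tree conditions concern letters appended at the end, so removing the first letter of a
  name preserves them; that letter selects the subtree.\<close>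

lemma product_tree_Suc:
  assumes root: "\<gamma> \<in> A"
    and X: "\<And>l. \<exists>\<phi>. arithmetic_product_tree U V j A \<phi> \<and> Level (\<phi> []) = Level \<gamma> + U \<and>
      descendent Gam_mult (\<phi> []) (Gam_X \<gamma> l)"
    and Y: "\<And>l. \<exists>\<phi>. arithmetic_product_tree U V j A \<phi> \<and> Level (\<phi> []) = Level \<gamma> + V \<and>
      descendent Gam_mult (\<phi> []) (Gam_Y \<gamma> l)"
  shows "\<exists>\<phi>. arithmetic_product_tree U V (Suc j) A \<phi> \<and> \<phi> [] = \<gamma>"
proof -
  obtain \<phi>X where \<phi>X: "\<And>l. arithmetic_product_tree U V j A (\<phi>X l)"
    "\<And>l. Level (\<phi>X l []) = Level \<gamma> + U" "\<And>l. descendent Gam_mult (\<phi>X l []) (Gam_X \<gamma> l)"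
    using X by metis
  obtain \<phi>Y where \<phi>Y: "\<And>l. arithmetic_product_tree U V j A (\<phi>Y l)"
    "\<And>l. Level (\<phi>Y l []) = Level \<gamma> + V" "\<And>l. descendent Gam_mult (\<phi>Y l []) (Gam_Y \<gamma> l)"
    using Y by metis
  define \<phi> where "\<phi> w = (case w of [] \<Rightarrow> \<gamma> | Inl l # w' \<Rightarrow> \<phi>X l w' | Inr l # w' \<Rightarrow> \<phi>Y l w')" for w
  have "\<phi> w \<in> A" if "w \<in> word_ball (Suc j)" for w
    using that root \<phi>X(1) \<phi>Y(1)
    by (auto simp: \<phi>_def word_ball_def arithmetic_product_tree_def split: list.split sum.split)
  moreover have "Level (\<phi> (w @ [Inl l])) = Level (\<phi> w) + U \<and> Level (\<phi> (w @ [Inr l])) = Level (\<phi> w) + V \<and>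
      descendent Gam_mult (\<phi> (w @ [Inl l])) (Gam_X (\<phi> w) l) \<and>
      descendent Gam_mult (\<phi> (w @ [Inr l])) (Gam_Y (\<phi> w) l)" if "length w < Suc j" for w l
  proof (cases w)
    case Nil
    then show ?thesis using \<phi>X \<phi>Y by (simp add: \<phi>_def)
  next
    case (Cons c w')
    then have "length w' < j" using that by simp
    then show ?thesis using Cons \<phi>X(1) \<phi>Y(1)
      by (cases c) (auto simp: \<phi>_def arithmetic_product_tree_def)
  qed
  ultimately have "arithmetic_product_tree U V (Suc j) A \<phi>"
    unfolding arithmetic_product_tree_def by blast
  moreover have "\<phi> [] = \<gamma>" by (simp add: \<phi>_def)
  ultimately show ?thesis by blast
qed

text \<open>The root is only required to lie \<open>K\<close> above \<open>y\<close>, because only the density of \<open>A\<close> at that level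
  above \<open>y\<close> is controlled.\<close>

definition tree_above ::
  "nat \<times> nat \<Rightarrow> nat \<times> nat \<Rightarrow> nat \<times> nat \<Rightarrow> nat \<Rightarrow> 'a Gam set \<Rightarrow> 'a Gam \<Rightarrow> bool" where
  "tree_above U V K j A y \<longleftrightarrow>
    (\<exists>\<phi>. arithmetic_product_tree U V j A \<phi> \<and> (\<exists>\<delta>\<in>lev K. \<phi> [] = Gam_mult y \<delta>))"

lemma tree_above_0:
  assumes "ldens A K y > 0"
  shows "tree_above U V K 0 A (y :: 'a::finite Gam)"
proof -
  obtain \<delta> where \<delta>: "\<delta> \<in> lev K" "ldens A K y \<le> of_bool (Gam_mult y \<delta> \<in> A)"
    using mean_le_imp_ex[OF finite_lev lev_nonempty order_refl] unfolding ldens_def by blast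
  then have "Gam_mult y \<delta> \<in> A" using assms by (cases "Gam_mult y \<delta> \<in> A") auto
  then have "arithmetic_product_tree U V 0 A (\<lambda>_. Gam_mult y \<delta>)"
    by (auto simp: arithmetic_product_tree_def)
  then show ?thesis using \<delta>(1) unfolding tree_above_def by blast
qed

text \<open>A union bound over letters. A one-letter extension of a point at level K above y is bad
  if no continuation of level P (or Q) ends at a node with a tree of order j. The expected number of
  bad letters is at most \<open>2 * card UNIV * \<sigma>\<close>, below the density of A, so some
  point of A has none. All roots lie K above their skeleton nodes, hence consecutive roots differ by
  exactly U or V.\<close>

lemma tree_above_Suc:
  fixes y :: "'a::finite Gam"
  assumes U: "U = K + (1, 0) + P" and V: "V = K + (0, 1) + Q"
    and uU: "mean (lev U) (\<lambda>\<delta>. of_bool (\<not> tree_above U V K j A (Gam_mult y \<delta>))) \<le> \<sigma>"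
    and uV: "mean (lev V) (\<lambda>\<delta>. of_bool (\<not> tree_above U V K j A (Gam_mult y \<delta>))) \<le> \<sigma>"
    and \<sigma>: "2 * real (card (UNIV :: 'a set)) * \<sigma> < ldens A K y"
  shows "tree_above U V K (Suc j) A y"
proof -
  let ?d = "real (card (UNIV :: 'a set))"
  define bX where "bX x \<longleftrightarrow> (\<forall>w\<in>lev P. \<not> tree_above U V K j A (Gam_mult y (Gam_mult x w)))" for x
  define bY where "bY x \<longleftrightarrow> (\<forall>w\<in>lev Q. \<not> tree_above U V K j A (Gam_mult y (Gam_mult x w)))" for x
  have d: "?d > 0" by (simp add: card_gt_0_iff)
  have mX: "mean (lev K) (\<lambda>\<delta>. \<Sum>l\<in>UNIV. of_bool (bX (Gam_mult \<delta> ([l], [])))) \<le> ?d * \<sigma>"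
  proof -
    have "mean (lev (K + (1, 0))) (\<lambda>x. of_bool (bX x)) \<le> mean (lev (K + (1, 0)))
      (\<lambda>x. mean (lev P) (\<lambda>w. of_bool (\<not> tree_above U V K j A (Gam_mult y (Gam_mult x w)))))"
    proof (intro mean_mono mean_ge)
      fix x w :: "'a Gam" assume "w \<in> lev P"
      then have "bX x \<Longrightarrow> \<not> tree_above U V K j A (Gam_mult y (Gam_mult x w))"
        unfolding bX_def by blast
      then show "of_bool (bX x) \<le> (of_bool (\<not> tree_above U V K j A (Gam_mult y (Gam_mult x w))) :: real)"
        by (cases "bX x") simp_all
    qed auto
    also have "\<dots> = mean (lev U) (\<lambda>\<delta>. of_bool (\<not> tree_above U V K j A (Gam_mult y \<delta>)))"
      using mean_lev_add[of "K + (1, 0)" P "\<lambda>\<delta>. of_bool (\<not> tree_above U V K j A (Gam_mult y \<delta>))",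
          folded U] by simp
    also note uU
    finally show ?thesis unfolding mean_lev_add mean_lev_10 using d
      by (simp add: mean_divide field_simps)
  qed
  have mY: "mean (lev K) (\<lambda>\<delta>. \<Sum>l\<in>UNIV. of_bool (bY (Gam_mult \<delta> ([], [l])))) \<le> ?d * \<sigma>"
  proof -
    have "mean (lev (K + (0, 1))) (\<lambda>x. of_bool (bY x)) \<le> mean (lev (K + (0, 1)))
      (\<lambda>x. mean (lev Q) (\<lambda>w. of_bool (\<not> tree_above U V K j A (Gam_mult y (Gam_mult x w)))))"
    proof (intro mean_mono mean_ge)
      fix x w :: "'a Gam" assume "w \<in> lev Q"
      then have "bY x \<Longrightarrow> \<not> tree_above U V K j A (Gam_mult y (Gam_mult x w))"
        unfolding bY_def by blast
      then show "of_bool (bY x) \<le> (of_bool (\<not> tree_above U V K j A (Gam_mult y (Gam_mult x w))) :: real)"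
        by (cases "bY x") simp_all
    qed auto
    also have "\<dots> = mean (lev V) (\<lambda>\<delta>. of_bool (\<not> tree_above U V K j A (Gam_mult y \<delta>)))"
      using mean_lev_add[of "K + (0, 1)" Q "\<lambda>\<delta>. of_bool (\<not> tree_above U V K j A (Gam_mult y \<delta>))",
          folded V] by simp
    also note uV
    finally show ?thesis unfolding mean_lev_add mean_lev_01 using d
      by (simp add: mean_divide field_simps)
  qed
  \<comment> \<open>Each bad letter subtracts 1, so a positive value means membership in A and no
    bad letter.\<close>
  let ?F = "\<lambda>\<delta>. of_bool (Gam_mult y \<delta> \<in> A) - (\<Sum>l\<in>UNIV. of_bool (bX (Gam_mult \<delta> ([l], []))))
      - (\<Sum>l\<in>UNIV. of_bool (bY (Gam_mult \<delta> ([], [l])))) :: real"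
  have F: "mean (lev K) ?F > 0"
    unfolding mean_diff using mX mY \<sigma> by (simp add: ldens_def)
  then obtain \<delta> where \<delta>: "\<delta> \<in> lev K" "mean (lev K) ?F \<le> ?F \<delta>"
    using mean_le_imp_ex[OF finite_lev lev_nonempty order_refl, of K ?F] by blast
  with F have F0: "?F \<delta> > 0" by simp
  have s0: "0 \<le> (\<Sum>l\<in>UNIV. of_bool (bX (Gam_mult \<delta> ([l :: 'a], []))) :: real)"
    "0 \<le> (\<Sum>l\<in>UNIV. of_bool (bY (Gam_mult \<delta> ([], [l :: 'a]))) :: real)"
    by (rule sum_nonneg; simp)+
  have A: "Gam_mult y \<delta> \<in> A" using F0 s0 by (cases "Gam_mult y \<delta> \<in> A") auto
  have nX: "\<not> bX (Gam_mult \<delta> ([l], []))" for l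
  proof
    assume "bX (Gam_mult \<delta> ([l], []))"
    then have "1 \<le> (\<Sum>l\<in>UNIV. of_bool (bX (Gam_mult \<delta> ([l], []))) :: real)"
      by (intro order_trans[OF _ member_le_sum[of l]]) auto
    with F0 s0(2) A show False by simp
  qed
  have nY: "\<not> bY (Gam_mult \<delta> ([], [l]))" for l
  proof
    assume "bY (Gam_mult \<delta> ([], [l]))"
    then have "1 \<le> (\<Sum>l\<in>UNIV. of_bool (bY (Gam_mult \<delta> ([], [l]))) :: real)"
      by (intro order_trans[OF _ member_le_sum[of l]]) auto
    with F0 s0(1) A show False by simp
  qed
  have "\<exists>\<phi>. arithmetic_product_tree U V (Suc j) A \<phi> \<and> \<phi> [] = Gam_mult y \<delta>"
  proof (rule product_tree_Suc[OF A])
    fix l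
    obtain w \<phi> \<epsilon> where w: "w \<in> lev P" "arithmetic_product_tree U V j A \<phi>" "\<epsilon> \<in> lev K"
      "\<phi> [] = Gam_mult (Gam_mult y (Gam_mult (Gam_mult \<delta> ([l], [])) w)) \<epsilon>"
      using nX[of l] unfolding bX_def tree_above_def by auto
    moreover have "\<phi> [] = Gam_mult (Gam_X (Gam_mult y \<delta>) l) (Gam_mult w \<epsilon>)"
      unfolding w(4) by (simp add: Gam_mult_def Gam_X_def)
    moreover have "Level (\<phi> []) = Level (Gam_mult y \<delta>) + U"
      using w \<delta>(1) by (simp add: U) (simp add: Level_def prod_eq_iff)
    ultimately show "\<exists>\<phi>. arithmetic_product_tree U V j A \<phi> \<and> Level (\<phi> []) = Level (Gam_mult y \<delta>) + U \<and>
        descendent Gam_mult (\<phi> []) (Gam_X (Gam_mult y \<delta>) l)"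
      unfolding descendent_def by blast
  next
    fix l
    obtain w \<phi> \<epsilon> where w: "w \<in> lev Q" "arithmetic_product_tree U V j A \<phi>" "\<epsilon> \<in> lev K"
      "\<phi> [] = Gam_mult (Gam_mult y (Gam_mult (Gam_mult \<delta> ([], [l])) w)) \<epsilon>"
      using nY[of l] unfolding bY_def tree_above_def by auto
    moreover have "\<phi> [] = Gam_mult (Gam_Y (Gam_mult y \<delta>) l) (Gam_mult w \<epsilon>)"
      unfolding w(4) by (simp add: Gam_mult_def Gam_Y_def)
    moreover have "Level (\<phi> []) = Level (Gam_mult y \<delta>) + V"
      using w \<delta>(1) by (simp add: V) (simp add: Level_def prod_eq_iff)
    ultimately show "\<exists>\<phi>. arithmetic_product_tree U V j A \<phi> \<and> Level (\<phi> []) = Level (Gam_mult y \<delta>) + V \<and>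
        descendent Gam_mult (\<phi> []) (Gam_Y (Gam_mult y \<delta>) l)"
      unfolding descendent_def by blast
  qed
  then show ?thesis using \<delta>(1) unfolding tree_above_def by blast
qed

text \<open>A node without a tree of order \<open>Suc j\<close> either has density below \<epsilon>
  or sees more than \<sigma> bad nodes at relative level U or V. Markov's inequality bounds each of
  the latter cases by \<open>1 / \<sigma>\<close> times the previous bad density, which costs a
  factor \<open>1 + 2 / \<sigma>\<close> per step.\<close>

lemma bad_density_bound:
  fixes y :: "'a::finite Gam" and K U V :: "nat \<times> nat" and pos :: "nat \<Rightarrow> nat \<Rightarrow> nat \<times> nat"
  assumes U: "U = K + (1, 0) + P" and V: "V = K + (0, 1) + Q"
    and \<sigma>: "\<sigma> > 0" "2 * real (card (UNIV :: 'a set)) * \<sigma> < \<epsilon>" and \<tau>: "\<tau> \<ge> 0"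
    and low: "\<And>a b. a + b \<le> r \<Longrightarrow>
      mean (lev (pos a b)) (\<lambda>\<delta>. of_bool (ldens A K (Gam_mult y \<delta>) < \<epsilon>)) \<le> \<tau>"
    and posU: "\<And>a b. pos (Suc a) b = pos a b + U" and posV: "\<And>a b. pos a (Suc b) = pos a b + V"
  shows "a + b + j \<le> r \<Longrightarrow>
    mean (lev (pos a b)) (\<lambda>\<delta>. of_bool (\<not> tree_above U V K j A (Gam_mult y \<delta>))) \<le> \<tau> * (1 + 2 / \<sigma>) ^ j"
proof (induction j arbitrary: a b)
  case 0
  have \<epsilon>: "\<epsilon> > 0" using \<sigma> by (smt (verit) mult_nonneg_nonneg of_nat_0_le_iff)
  have "mean (lev (pos a b)) (\<lambda>\<delta>. of_bool (\<not> tree_above U V K 0 A (Gam_mult y \<delta>)))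
    \<le> mean (lev (pos a b)) (\<lambda>\<delta>. of_bool (ldens A K (Gam_mult y \<delta>) < \<epsilon>))"
  proof (rule mean_mono)
    fix \<delta>
    show "of_bool (\<not> tree_above U V K 0 A (Gam_mult y \<delta>)) \<le> (of_bool (ldens A K (Gam_mult y \<delta>) < \<epsilon>) :: real)"
      using tree_above_0[of A K "Gam_mult y \<delta>" U V] \<epsilon> by (cases "ldens A K (Gam_mult y \<delta>) < \<epsilon>") auto
  qed
  with low[of a b] 0 show ?case by simp
next
  case (Suc j)
  let ?bad = "\<lambda>j z. of_bool (\<not> tree_above U V K j A z) :: real"
  define bU where "bU z = mean (lev U) (\<lambda>\<delta>. ?bad j (Gam_mult z \<delta>))" for z
  define bV where "bV z = mean (lev V) (\<lambda>\<delta>. ?bad j (Gam_mult z \<delta>))" for z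
  have b0: "bU z \<ge> 0" "bV z \<ge> 0" for z
    unfolding bU_def bV_def by (rule mean_nonneg; simp)+
  have pt: "?bad (Suc j) z \<le> of_bool (ldens A K z < \<epsilon>) + (1 / \<sigma>) * bU z + (1 / \<sigma>) * bV z" for z
  proof (cases "ldens A K z < \<epsilon> \<or> bU z > \<sigma> \<or> bV z > \<sigma>")
    case True
    have "0 \<le> (1 / \<sigma>) * bU z" "0 \<le> (1 / \<sigma>) * bV z" using b0 \<sigma> by simp_all
    moreover have "bU z > \<sigma> \<Longrightarrow> 1 \<le> (1 / \<sigma>) * bU z" "bV z > \<sigma> \<Longrightarrow> 1 \<le> (1 / \<sigma>) * bV z"
      using \<sigma> by (simp_all add: field_simps)
    moreover have "?bad (Suc j) z \<le> 1" "0 \<le> (of_bool (ldens A K z < \<epsilon>) :: real)" by simp_all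
    moreover have "ldens A K z < \<epsilon> \<Longrightarrow> of_bool (ldens A K z < \<epsilon>) = (1 :: real)" by simp
    ultimately show ?thesis using True by linarith
  next
    case False
    then have "tree_above U V K (Suc j) A z"
      using \<sigma> unfolding bU_def bV_def by (intro tree_above_Suc[OF U V, of j A z \<sigma>]) auto
    then show ?thesis using b0[of z] \<sigma> by simp
  qed
  let ?B = "\<tau> * (1 + 2 / \<sigma>) ^ j"
  have "mean (lev (pos a b)) (\<lambda>\<delta>. ?bad (Suc j) (Gam_mult y \<delta>))
    \<le> mean (lev (pos a b)) (\<lambda>\<delta>. of_bool (ldens A K (Gam_mult y \<delta>) < \<epsilon>)
        + (1 / \<sigma>) * bU (Gam_mult y \<delta>) + (1 / \<sigma>) * bV (Gam_mult y \<delta>))"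
    by (rule mean_mono) (rule pt)
  also have "\<dots> = mean (lev (pos a b)) (\<lambda>\<delta>. of_bool (ldens A K (Gam_mult y \<delta>) < \<epsilon>))
      + (1 / \<sigma>) * mean (lev (pos (Suc a) b)) (\<lambda>\<delta>. ?bad j (Gam_mult y \<delta>))
      + (1 / \<sigma>) * mean (lev (pos a (Suc b))) (\<lambda>\<delta>. ?bad j (Gam_mult y \<delta>))"
    unfolding mean_add mean_cmult posU posV mean_lev_add bU_def bV_def Gam_mult_assoc ..
  also have "\<dots> \<le> \<tau> + (1 / \<sigma>) * ?B + (1 / \<sigma>) * ?B"
    using Suc.prems \<sigma> by (intro add_mono mult_left_mono Suc.IH low) auto
  also have "\<dots> \<le> ?B + (1 / \<sigma>) * ?B + (1 / \<sigma>) * ?B"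
  proof -
    have "1 \<le> (1 + 2 / \<sigma>) ^ j" using \<sigma> by (intro one_le_power) simp
    then show ?thesis using \<tau> mult_left_mono[of 1 "(1 + 2 / \<sigma>) ^ j" \<tau>] by simp
  qed
  also have "\<dots> = \<tau> * (1 + 2 / \<sigma>) ^ Suc j" by (simp add: algebra_simps)
  finally show ?case .
qed

section \<open>Energy and conclusion\<close>

abbreviation box :: "nat \<Rightarrow> (nat \<times> nat) set" where
  "box N \<equiv> {..<N} \<times> {..<N}"

lemma sum_shift_le:
  fixes G :: "nat \<Rightarrow> real"
  assumes "\<And>i. 0 \<le> G i" "\<And>i. G i \<le> 1"
  shows "(\<Sum>i<N. G (i + a)) \<le> (\<Sum>i<N. G i) + real a"
proof -
  have "(\<Sum>i<N. G (i + a)) = (\<Sum>i\<in>{a..<N + a}. G i)"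
    using sum.shift_bounds_nat_ivl[of G 0 a N] by (simp add: lessThan_atLeast0)
  also have "\<dots> \<le> (\<Sum>i\<in>{..<N} \<union> {N..<N + a}. G i)"
    using assms by (intro sum_mono2) auto
  also have "\<dots> = (\<Sum>i<N. G i) + (\<Sum>i\<in>{N..<N + a}. G i)"
    by (rule sum.union_disjoint) auto
  also have "(\<Sum>i\<in>{N..<N + a}. G i) \<le> (\<Sum>i\<in>{N..<N + a}. 1)"
    using assms by (intro sum_mono) auto
  finally show ?thesis by simp
qed

text \<open>As the values lie in [0, 1], the error comes only from the strips by which the shifted
  box leaves the old one, one for each coordinate.\<close>

lemma mean_box_shift_le:
  fixes F :: "nat \<times> nat \<Rightarrow> real"
  assumes F: "\<And>l. 0 \<le> F l" "\<And>l. F l \<le> 1" and N: "N > 0"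
  shows "mean (box N) (\<lambda>l. F (l + s)) \<le> mean (box N) F + real (fst s + snd s) / real N"
proof -
  have shift: "mean {..<N} (\<lambda>i. G (i + a)) \<le> mean {..<N} G + real a / real N"
    if "\<And>i. 0 \<le> G i" "\<And>i. G i \<le> 1" for G a
    using divide_right_mono[OF sum_shift_le[of G a N, OF that], of "real N"]
    by (simp only: mean_def add_divide_distrib card_lessThan of_nat_0_le_iff)
  have N': "finite {..<N}" "{..<N} \<noteq> {}" using N by auto
  have "mean (box N) (\<lambda>l. F (l + s)) = mean {..<N} (\<lambda>i. mean {..<N} (\<lambda>j. F (i + fst s, j + snd s)))"
    by (simp add: mean_Times plus_prod_def)
  also have "\<dots> \<le> mean {..<N} (\<lambda>i. mean {..<N} (\<lambda>j. F (i + fst s, j)) + real (snd s) / real N)"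
    by (intro mean_mono shift F)
  also have "\<dots> = mean {..<N} (\<lambda>i. mean {..<N} (\<lambda>j. F (i + fst s, j))) + real (snd s) / real N"
    unfolding mean_add mean_const[OF N'] ..
  also have "\<dots> \<le> mean {..<N} (\<lambda>i. mean {..<N} (\<lambda>j. F (i, j))) + real (fst s) / real N + real (snd s) / real N"
    by (intro add_right_mono shift mean_nonneg mean_le F N')
  finally show ?thesis by (simp add: mean_Times add_divide_distrib)
qed

lemma mean_box_shift_ge:
  fixes F :: "nat \<times> nat \<Rightarrow> real"
  assumes F: "\<And>l. 0 \<le> F l" "\<And>l. F l \<le> 1" and N: "N > 0"
  shows "mean (box N) F - real (fst s + snd s) / real N \<le> mean (box N) (\<lambda>l. F (l + s))"
proof -
  have "mean (box N) (\<lambda>l. 1) = 1" using N by (intro mean_const) auto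
  then show ?thesis
    using mean_box_shift_le[of "\<lambda>l. 1 - F l" N s] F N by (simp add: mean_diff)
qed

section \<open>Second moments of relative densities\<close>

definition energy :: "'a Gam set \<Rightarrow> nat \<times> nat \<Rightarrow> nat \<times> nat \<Rightarrow> real" where
  "energy A l s = mean (lev l) (\<lambda>\<gamma>. (ldens A s \<gamma>)\<^sup>2)"

lemma energy_nonneg: "0 \<le> energy A l s"
  unfolding energy_def by (rule mean_nonneg) simp

lemma energy_le_1: "energy (A :: 'a::finite Gam set) l s \<le> 1"
  unfolding energy_def
  by (rule mean_le) (auto simp: ldens_nonneg ldens_le_1 power_le_one)

text \<open>\<open>ldens A (t + s) \<gamma>\<close> is the average of \<open>ldens A s\<close> over
  the descendents of \<gamma> at relative level t, so this is the orthogonality of martingale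
  increments.\<close>

lemma mean_variance_energy:
  fixes A :: "'a::finite Gam set"
  shows "mean (lev l) (\<lambda>\<gamma>. mean (lev t) (\<lambda>\<delta>. (ldens A s (Gam_mult \<gamma> \<delta>) - ldens A (t + s) \<gamma>)\<^sup>2))
    = energy A (l + t) s - energy A l (t + s)"
  unfolding ldens_add[of A t s] mean_variance[OF finite_lev lev_nonempty] mean_diff energy_def
    mean_lev_add ..

lemma energy_add_le:
  fixes A :: "'a::finite Gam set"
  shows "energy A l (t + s) \<le> energy A (l + t) s"
proof -
  have "0 \<le> energy A (l + t) s - energy A l (t + s)"
    unfolding mean_variance_energy[symmetric] by (intro mean_nonneg) simp
  then show ?thesis by simp
qed

text \<open>Energies are monotone only while the total level \<open>l + s\<close> is fixed.
  Averaging l over a large box absorbs the shifts by t and by t', where t' fills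
  \<open>t + (K, K)\<close> up to \<open>(K', K')\<close>.\<close>

lemma mean_box_variance_le:
  fixes A :: "'a::finite Gam set"
  assumes N: "N > 0" and K: "t + (K, K) + t' = (K', K')"
  shows "mean (box N) (\<lambda>l. mean (lev l) (\<lambda>\<gamma>. mean (lev t)
      (\<lambda>\<delta>. (ldens A (K, K) (Gam_mult \<gamma> \<delta>) - ldens A (t + (K, K)) \<gamma>)\<^sup>2)))
    \<le> mean (box N) (\<lambda>l. energy A l (K, K)) - mean (box N) (\<lambda>l. energy A l (K', K')) + 2 * real K' / real N"
proof -
  have K': "(K', K') = t' + (t + (K, K))" using K by (simp add: add_ac)
  have "mean (box N) (\<lambda>l. energy A l (K', K')) \<le> mean (box N) (\<lambda>l. energy A (l + t') (t + (K, K)))"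
    unfolding K' by (intro mean_mono energy_add_le)
  also have "\<dots> \<le> mean (box N) (\<lambda>l. energy A l (t + (K, K))) + real (fst t' + snd t') / real N"
    by (intro mean_box_shift_le energy_nonneg energy_le_1 N)
  finally have 1: "mean (box N) (\<lambda>l. energy A l (K', K'))
    \<le> mean (box N) (\<lambda>l. energy A l (t + (K, K))) + real (fst t' + snd t') / real N" .
  have 2: "mean (box N) (\<lambda>l. energy A (l + t) (K, K))
    \<le> mean (box N) (\<lambda>l. energy A l (K, K)) + real (fst t + snd t) / real N"
    by (intro mean_box_shift_le energy_nonneg energy_le_1 N)
  have "fst t + snd t + (fst t' + snd t') \<le> 2 * K'"
    using K by (cases t; cases t') auto
  then have "real (fst t + snd t) + real (fst t' + snd t') \<le> 2 * real K'" by linarith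
  from divide_right_mono[OF this, of "real N"]
  have "real (fst t + snd t) / real N + real (fst t' + snd t') / real N \<le> 2 * real K' / real N"
    by (simp add: add_divide_distrib)
  with 1 2 show ?thesis unfolding mean_variance_energy mean_diff by linarith
qed

lemma ex_small_decrement:
  fixes e :: "nat \<Rightarrow> real"
  assumes "\<And>j. 0 \<le> e j" "\<And>j. e j \<le> 1" "J > 0"
  shows "\<exists>j<J. e j - e (Suc j) \<le> 1 / real J"
proof (rule ccontr)
  assume "\<not> ?thesis"
  then have "(\<Sum>j<J. 1 / real J) < (\<Sum>j<J. e j - e (Suc j))"
    using assms(3) by (intro sum_strict_mono) (auto simp: not_le)
  also have "\<dots> = e 0 - e J" by (rule sum_lessThan_telescope')
  also have "\<dots> \<le> 1" using assms(1)[of J] assms(2)[of 0] by linarith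
  finally show False using assms(3) by simp
qed

lemma fst_scale [simp]: "fst (scale n x) = n * fst x" and snd_scale [simp]: "snd (scale n x) = n * snd x"
  by (simp_all add: scale_def)

text \<open>Since the energies are bounded, they are almost constant between two consecutive scales of a
  sequence that grows fast enough to reach beyond all levels that occur at the smaller scale.\<close>

lemma almost_deterministic_line:
  fixes A :: "'a::finite Gam set" and vec :: "nat \<Rightarrow> nat \<times> nat"
  assumes k: "k > 0" and \<epsilon>: "\<epsilon> > 0" and \<kappa>: "\<kappa> > 0"
    and freq: "\<And>N0. \<exists>N\<ge>N0. \<epsilon> \<le> mean (box N) (\<lambda>l. ldens A l ([], []))"
  shows "\<exists>K n l \<gamma>. l \<in> words {..k} n \<and> k \<in> set l \<and>
    (\<forall>i<k. let t = scale (Suc K) (sum_list (map vec (rep k i l))) in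
      \<epsilon> / 4 \<le> ldens A (t + (K, K)) \<gamma> \<and>
      mean (lev t) (\<lambda>\<delta>. (ldens A (K, K) (Gam_mult \<gamma> \<delta>) - ldens A (t + (K, K)) \<gamma>)\<^sup>2) \<le> \<kappa>)"
proof -
  have \<epsilon>4: "\<epsilon> / 4 > 0" using \<epsilon> by simp
  obtain n where n: "\<And>A. \<epsilon> / 4 \<le> dens k n A \<Longrightarrow> has_line k n A"
    using density_hales_jewett[OF k] \<epsilon>4 unfolding dhj_def by meson
  define c where "c = (\<epsilon> / 4) / real ((k + 1) ^ n)"
  have c: "c > 0" using \<epsilon> by (simp add: c_def)
  \<comment> \<open>Chosen so that the variances of the k points of a line, summed and divided by
    \<kappa>, average to at most \<open>c / 2\<close>.\<close>
  define \<eta> where "\<eta> = c * \<kappa> / (2 * real k)"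
  have \<eta>: "\<eta> > 0" using c \<kappa> k by (simp add: \<eta>_def)
  define W where "W = words {..<k} n"
  have W: "finite W" "W \<noteq> {}" using k by (auto simp: W_def)
  define \<sigma> where "\<sigma> x = sum_list (map vec x)" for x
  define Z where "Z = (\<Sum>x\<in>W. fst (\<sigma> x) + snd (\<sigma> x))"
  have Z: "fst (\<sigma> x) \<le> Z" "snd (\<sigma> x) \<le> Z" if "x \<in> W" for x
    using member_le_sum[of x W "\<lambda>x. fst (\<sigma> x) + snd (\<sigma> x)"] that W unfolding Z_def by auto
  \<comment> \<open>The next scale dominates both coordinates of
    \<open>scale (Suc K) (\<sigma> x) + (K, K)\<close> for all words x in W.\<close>
  define Kf where "Kf = rec_nat (0::nat) (\<lambda>_ K. K + Suc K * Z)"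
  have Kf: "Kf (Suc j) = Kf j + Suc (Kf j) * Z" for j by (simp add: Kf_def)
  have Kf_mono: "Kf i \<le> Kf j" if "i \<le> j" for i j
    by (rule lift_Suc_mono_le[OF _ that]) (simp add: Kf)
  obtain J where J: "2 / \<eta> < real J" using reals_Archimedean2 by blast
  then have J0: "J > 0" using \<eta> by (smt (verit) divide_pos_pos of_nat_0_less_iff)
  have J2: "1 / real J \<le> \<eta> / 2" using J J0 \<eta> by (simp add: field_simps)
  \<comment> \<open>N is chosen with respect to the largest scale \<open>Kf J\<close>, because the
    index j of the suitable scale depends on N.\<close>
  define R where "R = 2 * real (Kf J) / min (\<eta> / 2) (\<epsilon> / 4)"
  obtain N0 where N0: "R < real N0" using reals_Archimedean2 by blast
  obtain N where N: "N \<ge> Suc N0" "\<epsilon> \<le> mean (box N) (\<lambda>l. ldens A l ([], []))"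
    using freq by blast
  have Npos: "N > 0" using N(1) by simp
  have "R < real N" using N0 N(1) by simp
  then have "2 * real (Kf J) < real N * min (\<eta> / 2) (\<epsilon> / 4)"
    using \<eta> \<epsilon> unfolding R_def by (simp add: divide_less_eq)
  then have "2 * real (Kf J) / real N < min (\<eta> / 2) (\<epsilon> / 4)"
    using Npos by (simp only: divide_less_eq of_nat_0_less_iff if_True mult.commute)
  then have err: "2 * real (Kf J) / real N < \<eta> / 2" "2 * real (Kf J) / real N < \<epsilon> / 4" by simp_all
  have boxN: "finite (box N)" "box N \<noteq> {}" using Npos by auto
  obtain j where j: "j < J" "mean (box N) (\<lambda>l. energy A l (Kf j, Kf j))
      - mean (box N) (\<lambda>l. energy A l (Kf (Suc j), Kf (Suc j))) \<le> 1 / real J"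
    using ex_small_decrement[of "\<lambda>j. mean (box N) (\<lambda>l. energy A l (Kf j, Kf j))" J] J0
      mean_le[OF boxN] mean_nonneg energy_nonneg energy_le_1 by metis
  define K where "K = Kf j"
  define K' where "K' = Kf (Suc j)"
  have K': "K' = K + Suc K * Z" unfolding K_def K'_def by (rule Kf)
  have "Kf (Suc j) \<le> Kf J" using j(1) by (intro Kf_mono) simp
  then have "2 * real K' / real N \<le> 2 * real (Kf J) / real N"
    unfolding K'_def by (intro divide_right_mono) auto
  with err have err': "2 * real K' / real N \<le> \<eta> / 2" "2 * real K' / real N \<le> \<epsilon> / 4" by simp_all
  define t where "t x = scale (Suc K) (\<sigma> x)" for x
  have t: "fst (t x) \<le> Suc K * Z" "snd (t x) \<le> Suc K * Z" if "x \<in> W" for x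
    using Z[OF that] unfolding t_def by (auto simp del: mult_Suc intro: mult_le_mono2)
  define M where "M f = mean (box N) (\<lambda>l. mean (lev l) f)" for f :: "'a Gam \<Rightarrow> real"
  define V where "V x \<gamma> = mean (lev (t x))
      (\<lambda>\<delta>. (ldens A (K, K) (Gam_mult \<gamma> \<delta>) - ldens A (t x + (K, K)) \<gamma>)\<^sup>2)" for x \<gamma>
  have M_V: "M (V x) \<le> \<eta>" if x: "x \<in> W" for x
  proof -
    have "t x + (K, K) + (K' - K - fst (t x), K' - K - snd (t x)) = (K', K')"
      using t[OF x] by (simp add: K' prod_eq_iff)
    from mean_box_variance_le[OF Npos this, of A] show ?thesis
      using j(2) err' J2 unfolding M_def V_def K_def[symmetric] K'_def[symmetric] by linarith
  qed
  have M_mono: "M f \<le> M g" if "\<And>\<gamma>. f \<gamma> \<le> g \<gamma>" for f g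
    unfolding M_def by (intro mean_mono that)
  have M_add: "M (\<lambda>\<gamma>. f \<gamma> + g \<gamma>) = M f + M g" for f g
    unfolding M_def mean_add ..
  have M_sum: "M (\<lambda>\<gamma>. \<Sum>x\<in>X. f x \<gamma>) = (\<Sum>x\<in>X. M (f x))" for f and X :: "'c set"
    unfolding M_def mean_sum ..
  have M_const: "M (\<lambda>_. a) = a" for a
    unfolding M_def mean_lev_const by (rule mean_const[OF boxN])
  define D where "D \<gamma> = {x. \<epsilon> / 4 \<le> ldens A (t x + (K, K)) \<gamma>}" for \<gamma>
  have low: "3 / 4 * \<epsilon> \<le> M (ldens A (t x + (K, K)))" if x: "x \<in> W" for x
  proof -
    let ?s = "t x + (K, K)"
    have "fst ?s + snd ?s \<le> 2 * K'" using t[OF x] by (simp add: K')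
    then have "real (fst ?s + snd ?s) / real N \<le> 2 * real K' / real N"
      by (intro divide_right_mono) linarith+
    then have "3 / 4 * \<epsilon> \<le> mean (box N) (\<lambda>l. ldens A l ([], [])) - real (fst ?s + snd ?s) / real N"
      using err'(2) N(2) by linarith
    also have "\<dots> \<le> mean (box N) (\<lambda>l. ldens A (l + ?s) ([], []))"
      by (intro mean_box_shift_ge[of "\<lambda>l. ldens A l ([], [])"] ldens_nonneg ldens_le_1 Npos)
    also have "\<dots> = M (ldens A ?s)"
      unfolding M_def ldens_add[of A _ ?s] by (simp add: Gam_mult_def)
    finally show ?thesis .
  qed
  have "3 / 4 * \<epsilon> \<le> mean W (\<lambda>x. M (ldens A (t x + (K, K))))"
    by (rule mean_ge[OF W]) (rule low)
  also have "\<dots> = M (\<lambda>\<gamma>. mean W (\<lambda>x. ldens A (t x + (K, K)) \<gamma>))"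
    unfolding M_def by (subst mean_swap, rule mean_cong, rule mean_swap)
  \<comment> \<open>One \<open>\<epsilon> / 4\<close> bounds the density outside
    \<open>D \<gamma>\<close>, the other is the threshold of \<open>dens_le_sum_lines\<close>; of
    \<open>3 / 4 * \<epsilon>\<close> a quarter of \<epsilon> remains for the lines.\<close>
  also have "\<dots> \<le> M (\<lambda>\<gamma>. \<epsilon> / 4 + (\<epsilon> / 4
      + (\<Sum>l | l \<in> words {..k} n \<and> k \<in> set l. of_bool (\<forall>i<k. rep k i l \<in> D \<gamma>))))"
  proof (rule M_mono)
    fix \<gamma>
    have "mean W (\<lambda>x. ldens A (t x + (K, K)) \<gamma>) \<le> mean W (\<lambda>x. \<epsilon> / 4 + of_bool (x \<in> D \<gamma>))"
    proof (rule mean_mono)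
      fix x
      show "ldens A (t x + (K, K)) \<gamma> \<le> \<epsilon> / 4 + of_bool (x \<in> D \<gamma>)"
        using ldens_le_1[of A "t x + (K, K)" \<gamma>] \<epsilon> by (cases "x \<in> D \<gamma>") (auto simp: D_def)
    qed
    also have "\<dots> = \<epsilon> / 4 + dens k n (D \<gamma>)"
      unfolding mean_add mean_const[OF W] by (simp add: dens_def W_def)
    also note dens_le_sum_lines[OF k n \<epsilon>4, of "D \<gamma>"]
    finally show "mean W (\<lambda>x. ldens A (t x + (K, K)) \<gamma>) \<le> \<epsilon> / 4 + (\<epsilon> / 4
      + (\<Sum>l | l \<in> words {..k} n \<and> k \<in> set l. of_bool (\<forall>i<k. rep k i l \<in> D \<gamma>)))" by simp
  qed
  also have "\<dots> = \<epsilon> / 4 + (\<epsilon> / 4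
      + (\<Sum>l | l \<in> words {..k} n \<and> k \<in> set l. M (\<lambda>\<gamma>. of_bool (\<forall>i<k. rep k i l \<in> D \<gamma>))))"
    unfolding M_add M_sum M_const ..
  finally have "\<epsilon> / 4 \<le> (\<Sum>l | l \<in> words {..k} n \<and> k \<in> set l. M (\<lambda>\<gamma>. of_bool (\<forall>i<k. rep k i l \<in> D \<gamma>)))"
    by simp
  from ex_line_of_sum[OF this \<epsilon>4] obtain l where l: "l \<in> words {..k} n" "k \<in> set l"
    "c \<le> M (\<lambda>\<gamma>. of_bool (\<forall>i<k. rep k i l \<in> D \<gamma>))" unfolding c_def by blast
  have lW: "rep k i l \<in> W" if "i < k" for i unfolding W_def by (rule rep_words[OF that l(1)])
  let ?S = "\<lambda>\<gamma>. \<Sum>i<k. V (rep k i l) \<gamma>"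
  \<comment> \<open>A positive value forces the whole line into \<open>D \<gamma>\<close> and the
    total variance below \<kappa> at the same node \<gamma>.\<close>
  let ?h = "\<lambda>\<gamma>. of_bool (\<forall>i<k. rep k i l \<in> D \<gamma>) - (1 / \<kappa>) * ?S \<gamma>"
  have V0: "0 \<le> V x \<gamma>" for x \<gamma> unfolding V_def by (rule mean_nonneg) simp
  have "M ?S \<le> (\<Sum>i<k. \<eta>)"
    unfolding M_sum using M_V lW by (intro sum_mono) auto
  then have "(1 / \<kappa>) * M ?S \<le> (1 / \<kappa>) * (real k * \<eta>)"
    using \<kappa> by (intro mult_left_mono) auto
  also have "\<dots> = c / 2" using \<kappa> k by (simp add: \<eta>_def)
  finally have "c / 2 \<le> M ?h"
    using l(3) unfolding M_def mean_diff mean_cmult by simp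
  then obtain L where "c / 2 \<le> mean (lev L) ?h"
    using mean_le_imp_ex[OF boxN] unfolding M_def by blast
  then obtain \<gamma> where "c / 2 \<le> ?h \<gamma>"
    using mean_le_imp_ex[OF finite_lev lev_nonempty] by blast
  then have h: "0 < ?h \<gamma>" using c by linarith
  have S0: "0 \<le> ?S \<gamma>" by (rule sum_nonneg) (rule V0)
  then have "0 \<le> (1 / \<kappa>) * ?S \<gamma>" using \<kappa> by simp
  with h have D: "\<forall>i<k. rep k i l \<in> D \<gamma>" by (cases "\<forall>i<k. rep k i l \<in> D \<gamma>") (simp_all only: of_bool_eq)
  then have "of_bool (\<forall>i<k. rep k i l \<in> D \<gamma>) = (1 :: real)" by simp
  with h have "(1 / \<kappa>) * ?S \<gamma> < 1" by linarith
  then have S: "?S \<gamma> < \<kappa>" using \<kappa> by (simp add: field_simps)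
  have "V (rep k i l) \<gamma> \<le> \<kappa>" if "i < k" for i
    using member_le_sum[of i "{..<k}" "\<lambda>i. V (rep k i l) \<gamma>"] that V0 S by simp
  with D l(1,2) show ?thesis
    unfolding D_def V_def t_def \<sigma>_def Let_def by blast
qed

text \<open>A positive limsup provides arbitrarily large good N, not all large N; hence the scales
  are bounded before N is picked.\<close>

lemma upper_density_pos:
  fixes A :: "'a::finite Gam set"
  assumes "upper_density A > 0"
  shows "\<exists>\<epsilon>>0. \<forall>N0. \<exists>N\<ge>N0. \<epsilon> \<le> mean (box N) (\<lambda>l. ldens A l ([], []))"
proof -
  let ?f = "\<lambda>N. 1 / (real N)\<^sup>2 * (\<Sum>i<N. \<Sum>j<N. real (card (A \<inter> level_set i j)) / real (card (level_set i j :: 'a Gam set)))"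
  have "real (card (A \<inter> level_set i j)) / real (card (level_set i j :: 'a Gam set)) = ldens A (i, j) ([], [])" for i j
    by (simp add: ldens_def mean_def level_set_def Gam_mult_def of_bool_def sum.If_cases
        finite_lev Int_commute Collect_conj_eq[symmetric] Int_def)
  then have f: "?f N = mean (box N) (\<lambda>l. ldens A l ([], []))" for N
    by (simp add: mean_def sum.cartesian_product power2_eq_square case_prod_unfold)
  obtain \<epsilon> where \<epsilon>: "0 < ereal \<epsilon>" "ereal \<epsilon> < upper_density A"
    using ereal_dense2[OF assms] by auto
  let ?F = "\<lambda>N. mean (box N) (\<lambda>l. ldens A l ([], []))"
  have "\<exists>N\<ge>N0. \<epsilon> \<le> ?F N" for N0
  proof (rule ccontr)
    assume "\<not> ?thesis"
    then have "ereal (?F N) \<le> ereal \<epsilon>" if "N \<ge> N0" for N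
      using that by (simp only: ereal_less_eq) (meson le_cases)
    then have "limsup (\<lambda>N. ereal (?F N)) \<le> ereal \<epsilon>"
      by (intro Limsup_bounded eventually_sequentiallyI)
    then have "upper_density A \<le> ereal \<epsilon>"
      unfolding upper_density_def f .
    with \<epsilon>(2) show False by simp
  qed
  then show ?thesis using \<epsilon>(1) by auto
qed

text \<open>Along a line the level is an offset plus a fixed multiple of \<open>vec i\<close>, the
  multiple being the number of variable positions.\<close>

lemma sum_list_map_rep:
  "sum_list (map vec (rep k i l)) = sum_list (map vec (filter (\<lambda>c. c \<noteq> k) l))
    + scale (length (filter (\<lambda>c. c = k) l)) (vec i)"
  by (induction l) (auto simp: rep_def scale_def prod_eq_iff)

theorem theorem1p7:
  fixes A :: "('a::finite list \<times> 'a list) set"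
    and u v :: "nat \<times> nat"
    and r :: nat
  assumes "upper_density A > 0"
    and "fst u > 0" and "snd u > 0"
    and "fst v > 0" and "snd v > 0"
    and "r > 0"
  shows "\<exists>n>0. \<exists>\<phi>. arithmetic_product_tree (scale n u) (scale n v) r A \<phi>"
proof -
  obtain \<epsilon> where \<epsilon>: "\<epsilon> > 0" and freq: "\<And>N0. \<exists>N\<ge>N0. \<epsilon> \<le> mean (box N) (\<lambda>l. ldens A l ([], []))"
    using upper_density_pos[OF assms(1)] by blast
  let ?d = "real (card (UNIV :: 'a set))"
  have d: "?d > 0" by (simp add: card_gt_0_iff)
  \<comment> \<open>The constants are found backwards: \<sigma> meets the union bound of
    \<open>tree_above_Suc\<close> at density \<open>\<epsilon> / 8\<close>, \<tau> leaves bad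
    density \<open>1 / 2\<close> after r steps, and \<kappa> is what Chebyshev's inequality with
    deviation \<open>\<epsilon> / 8\<close> requires for \<tau>.\<close>
  define \<sigma> where "\<sigma> = \<epsilon> / (32 * ?d)"
  have \<sigma>: "\<sigma> > 0" "2 * ?d * \<sigma> < \<epsilon> / 8" using \<epsilon> d by (simp_all add: \<sigma>_def)
  define q where "q = (1 + 2 / \<sigma>) ^ r"
  have q: "q > 0" using \<sigma> by (simp add: q_def add_pos_pos)
  define \<tau> where "\<tau> = 1 / (2 * q)"
  have \<tau>: "\<tau> > 0" using q by (simp add: \<tau>_def)
  define \<kappa> where "\<kappa> = \<tau> * \<epsilon>\<^sup>2 / 64"
  have \<kappa>: "\<kappa> > 0" using \<tau> \<epsilon> by (simp add: \<kappa>_def)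
  \<comment> \<open>The pair \<open>(a, b)\<close> is coded as the letter
    \<open>a * Suc r + b\<close>.\<close>
  define k where "k = Suc r * Suc r"
  have k: "k > 0" by (simp add: k_def)
  define vec where "vec c = scale (c div Suc r) u + scale (c mod Suc r) v" for c
  obtain K n l \<gamma> where l: "l \<in> words {..k} n" "k \<in> set l" and line: "\<And>i. i < k \<Longrightarrow>
    let t = scale (Suc K) (sum_list (map vec (rep k i l))) in
      \<epsilon> / 4 \<le> ldens A (t + (K, K)) \<gamma> \<and>
      mean (lev t) (\<lambda>\<delta>. (ldens A (K, K) (Gam_mult \<gamma> \<delta>) - ldens A (t + (K, K)) \<gamma>)\<^sup>2) \<le> \<kappa>"
    using almost_deterministic_line[OF k \<epsilon> \<kappa> freq, of vec] by blast
  define m where "m = Suc K * length (filter (\<lambda>c. c = k) l)"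
  have "filter (\<lambda>c. c = k) l \<noteq> []" using l(2) by (simp add: filter_empty_conv)
  then have "Suc K * 1 \<le> m" unfolding m_def by (intro mult_le_mono2) (simp add: Suc_le_eq)
  then have m: "Suc K \<le> m" by simp
  define pos where "pos a b = scale (Suc K) (sum_list (map vec (filter (\<lambda>c. c \<noteq> k) l)))
      + scale m (scale a u + scale b v)" for a b
  let ?U = "scale m u" and ?V = "scale m v"
  \<comment> \<open>Here positivity of u and v enters: each coordinate of a step has room for K
    levels and one more letter.\<close>
  have big: "Suc K \<le> m * x" if "x > 0" for x
    using m that by (metis Suc_leI le_trans mult_le_mono2 mult.right_neutral One_nat_def)
  have U: "?U = (K, K) + (1, 0) + (m * fst u - Suc K, m * snd u - K)"
    using big[OF assms(2)] big[OF assms(3)] by (simp add: prod_eq_iff)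
  have V: "?V = (K, K) + (0, 1) + (m * fst v - K, m * snd v - Suc K)"
    using big[OF assms(4)] big[OF assms(5)] by (simp add: prod_eq_iff)
  have low: "mean (lev (pos a b)) (\<lambda>\<delta>. of_bool (ldens A (K, K) (Gam_mult \<gamma> \<delta>) < \<epsilon> / 8)) \<le> \<tau>"
    if ab: "a + b \<le> r" for a b
  proof -
    let ?i = "a * Suc r + b"
    have i: "?i < k" "?i div Suc r = a" "?i mod Suc r = b"
    proof -
      have "a * Suc r \<le> r * Suc r" using ab by (intro mult_le_mono1) simp
      then show "?i < k" using ab by (simp add: k_def)
    qed (use ab in \<open>simp_all del: mult_Suc_right\<close>)
    have "scale (Suc K) (sum_list (map vec (rep k ?i l))) = pos a b"
      unfolding sum_list_map_rep vec_def[of ?i] i pos_def m_def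
      by (simp add: prod_eq_iff algebra_simps)
    with line[OF i(1)] have D: "\<epsilon> / 4 \<le> ldens A (pos a b + (K, K)) \<gamma>" and
      V: "mean (lev (pos a b)) (\<lambda>\<delta>. (ldens A (K, K) (Gam_mult \<gamma> \<delta>) - ldens A (pos a b + (K, K)) \<gamma>)\<^sup>2) \<le> \<kappa>"
      by (simp_all add: Let_def)
    have "mean (lev (pos a b)) (\<lambda>\<delta>. of_bool (ldens A (K, K) (Gam_mult \<gamma> \<delta>) < \<epsilon> / 8))
      \<le> mean (lev (pos a b)) (\<lambda>\<delta>. (64 / \<epsilon>\<^sup>2) * (ldens A (K, K) (Gam_mult \<gamma> \<delta>) - ldens A (pos a b + (K, K)) \<gamma>)\<^sup>2)"
    proof (rule mean_mono)
      fix \<delta>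
      let ?g = "ldens A (K, K) (Gam_mult \<gamma> \<delta>)" and ?D = "ldens A (pos a b + (K, K)) \<gamma>"
      show "of_bool (?g < \<epsilon> / 8) \<le> (64 / \<epsilon>\<^sup>2) * (?g - ?D)\<^sup>2"
      proof (cases "?g < \<epsilon> / 8")
        case True
        then have "\<epsilon> / 8 \<le> ?D - ?g" using D by linarith
        then have "(\<epsilon> / 8)\<^sup>2 \<le> (?D - ?g)\<^sup>2" using \<epsilon> by (intro power_mono) auto
        then show ?thesis using True \<epsilon> by (simp add: field_simps power2_commute)
      qed simp
    qed
    also have "\<dots> \<le> (64 / \<epsilon>\<^sup>2) * \<kappa>"
      unfolding mean_cmult using V by (intro mult_left_mono) auto
    also have "\<dots> = \<tau>" using \<epsilon> by (simp add: \<kappa>_def)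
    finally show ?thesis .
  qed
  have posU: "pos (Suc a) b = pos a b + ?U" and posV: "pos a (Suc b) = pos a b + ?V" for a b
    by (simp_all add: pos_def scale_def algebra_simps)
  have "mean (lev (pos 0 0)) (\<lambda>\<delta>. of_bool (\<not> tree_above ?U ?V (K, K) r A (Gam_mult \<gamma> \<delta>)))
    \<le> \<tau> * (1 + 2 / \<sigma>) ^ r"
    by (rule bad_density_bound[where pos = pos and r = r, OF U V \<sigma> less_imp_le[OF \<tau>] low posU posV]) auto
  also have "\<dots> = 1 / 2" using q by (simp add: \<tau>_def q_def[symmetric])
  finally have bad: "mean (lev (pos 0 0)) (\<lambda>\<delta>. of_bool (\<not> tree_above ?U ?V (K, K) r A (Gam_mult \<gamma> \<delta>))) \<le> 1 / 2" .
  have "\<exists>\<delta>. tree_above ?U ?V (K, K) r A (Gam_mult \<gamma> \<delta>)"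
  proof (rule ccontr)
    assume "\<not> ?thesis"
    then have "\<not> tree_above ?U ?V (K, K) r A (Gam_mult \<gamma> \<delta>)" for \<delta> by blast
    with bad show False by simp
  qed
  then obtain \<phi> where "arithmetic_product_tree ?U ?V r A \<phi>" unfolding tree_above_def by blast
  moreover have "m > 0" using m by simp
  ultimately show ?thesis by blast
qed

end
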